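(* Let $p\ge2$ be an integer and $\alpha \in (0, 1/4]$. Any (one-way) communication protocol that achieves advantage $\epsilon > 0$ for the $p$-ary Hidden Matching problem with parameters $n,\alpha$ requires at least $\Omega(\epsilon \sqrt{n})$ bits of communication from Alice to Bob, where the constant in the $\Omega$-notation does not depend on $n$ or $\epsilon$.
   Context: The $p$-ary Hidden Matching problem (with $\alpha n$ an integer): Alice gets a uniformly random $x \in \mathbb{Z}_p^n$. Bob gets a uniformly random $\alpha$-partial matching $G$ (a matching with exactly $\alpha n$ edges on $\{1,\dots,n\}$), with incidence matrix $M \in \{0,1\}^{\alpha n \times n}$ ($M_{ev}=1$ iff $v$ is an endpoint of $e$), and a vector $w \in \mathbb{Z}_p^{\alpha n}$. In the YES distribution $w = Mx$ (arithmetic modulo $p$), i.e. $w_e=x_u+x_v$ for each edge $e=(u,v)$; in the NO distribution $w$ is uniformly random in $\mathbb{Z}_p^{\alpha n}$, independent of $x$. Alice sends a single message to Bob, who then outputs Yes or No based on the message and his input $(G,w)$. The protocol achieves advantage $\epsilon$ if the probability that Bob outputs Yes under the YES distribution and under the NO distribution differ by at least $\epsilon$. *)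

theory Defs
  imports "HOL-Probability.Probability"
begin

text \<open>\<open>\<int>\<^sub>p\<close> is represented by the residues \<open>0, \<dots>, p - 1\<close>, and a vector over \<open>\<int>\<^sub>p\<close> with coordinates
  indexed by \<open>I\<close> by an extensional function on \<open>I\<close>.\<close>

definition Zvec :: "nat \<Rightarrow> 'i set \<Rightarrow> ('i \<Rightarrow> nat) set" where
  "Zvec p I = I \<rightarrow>\<^sub>E {0..<p}"

definition partial_matchings :: "nat \<Rightarrow> nat \<Rightarrow> nat set set set" where
  "partial_matchings n m =
     {G. (\<forall>e\<in>G. e \<subseteq> {1..n} \<and> card e = 2) \<and> pairwise disjnt G \<and> card G = m}"

definition incidence :: "nat set \<Rightarrow> nat \<Rightarrow> nat" where
  "incidence e v = (if v \<in> e then 1 else 0)"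

text \<open>The product \<open>M x\<close> modulo \<open>p\<close>, where the rows of \<open>M\<close> are indexed by the edges of \<open>G\<close> themselves,
  so that no enumeration of the edges has to be chosen.\<close>

definition incidence_mult :: "nat \<Rightarrow> nat \<Rightarrow> nat set set \<Rightarrow> (nat \<Rightarrow> nat) \<Rightarrow> nat set \<Rightarrow> nat" where
  "incidence_mult p n G x = (\<lambda>e\<in>G. (\<Sum>v\<in>{1..n}. incidence e v * x v) mod p)"

definition yes_dist ::
  "nat \<Rightarrow> nat \<Rightarrow> nat \<Rightarrow> ((nat \<Rightarrow> nat) \<times> nat set set \<times> (nat set \<Rightarrow> nat)) pmf" where
  "yes_dist p n m = do {
     x \<leftarrow> pmf_of_set (Zvec p {1..n});
     G \<leftarrow> pmf_of_set (partial_matchings n m);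
     return_pmf (x, G, incidence_mult p n G x)
   }"

definition no_dist ::
  "nat \<Rightarrow> nat \<Rightarrow> nat \<Rightarrow> ((nat \<Rightarrow> nat) \<times> nat set set \<times> (nat set \<Rightarrow> nat)) pmf" where
  "no_dist p n m = do {
     x \<leftarrow> pmf_of_set (Zvec p {1..n});
     G \<leftarrow> pmf_of_set (partial_matchings n m);
     w \<leftarrow> pmf_of_set (Zvec p G);
     return_pmf (x, G, w)
   }"

text \<open>One-way protocols with both public randomness (the shared seed) and private randomness (the
  pmf-valued maps of Alice and Bob). Taking the seed from \<open>nat\<close> loses no generality: for
  fixed parameters there are only finitely many inputs and messages, hence only finitely many
  deterministic protocols to randomize over.\<close>

record protocol =
  seed :: "nat pmf"
  alice :: "nat \<Rightarrow> (nat \<Rightarrow> nat) \<Rightarrow> bool list pmf"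
  bob :: "nat \<Rightarrow> bool list \<Rightarrow> nat set set \<Rightarrow> (nat set \<Rightarrow> nat) \<Rightarrow> bool pmf"

text \<open>Worst-case communication: over all inputs of Alice and all randomness, she sends at most
  \<open>c\<close> bits.\<close>

definition communicates_at_most :: "nat \<Rightarrow> nat \<Rightarrow> protocol \<Rightarrow> nat \<Rightarrow> bool" where
  "communicates_at_most p n P c \<longleftrightarrow>
     (\<forall>r\<in>set_pmf (seed P). \<forall>x\<in>Zvec p {1..n}. \<forall>msg\<in>set_pmf (alice P r x). length msg \<le> c)"

definition bob_output ::
  "protocol \<Rightarrow> ((nat \<Rightarrow> nat) \<times> nat set set \<times> (nat set \<Rightarrow> nat)) pmf \<Rightarrow> bool pmf" where
  "bob_output P D = do {
     r \<leftarrow> seed P;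
     (x, G, w) \<leftarrow> D;
     msg \<leftarrow> alice P r x;
     bob P r msg G w
   }"

definition achieves_advantage :: "nat \<Rightarrow> nat \<Rightarrow> nat \<Rightarrow> protocol \<Rightarrow> real \<Rightarrow> bool" where
  "achieves_advantage p n m P \<epsilon> \<longleftrightarrow>
     \<bar>pmf (bob_output P (yes_dist p n m)) True - pmf (bob_output P (no_dist p n m)) True\<bar> \<ge> \<epsilon>"

end

theory Submission imports Defs begin

text \<open>Fix the seed and a message, and let \<open>f x\<close> be the probability that Alice sends this message on input
  \<open>x\<close>, with mean \<open>\<mu>\<close>. Averaged over the matching, Bob's gain from this message is at most the
  \<open>L\<^sup>1\<close> distance between the \<open>f\<close>-weighted law of \<open>M x\<close> and \<open>\<mu>\<close> times the uniform law. By
  Cauchy-Schwarz and Parseval its square is at most \<open>\<Sum> \<bar>f^(M\<^sup>T s)\<bar>\<^sup>2\<close> over \<open>s \<noteq> 0\<close>. The support of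
  \<open>M\<^sup>T s\<close> is a union of \<open>k\<close> edges, and a given set of \<open>2k\<close> vertices is a union of edges of a random
  matching with probability \<open>(m choose k) / (n choose 2k) \<le> (2k / n)^k\<close>. Hypercontractivity bounds the
  Fourier weight of \<open>f\<close> at level \<open>2k\<close> by \<open>\<mu>\<^sup>2 (c L / k)^(2k)\<close> for \<open>k \<le> L = 1 - ln \<mu>\<close>, so that the
  gain is \<open>O(\<mu> L / \<surd>n)\<close>. Summing over the at most \<open>2^(c + 1)\<close> messages, the entropy bound turns
  \<open>\<Sum> \<mu> L\<close> into \<open>O(c)\<close>.\<close>

section \<open>Hypercontractivity on product spaces\<close>

text \<open>No sharp hypercontractive constant is needed: a factor lost in the noise rate returns as
  a constant to the power \<open>2k\<close>, hence only in the ratio of the geometric series over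
  \<open>k\<close>. A crude one-coordinate inequality with noise rate of order \<open>1/p\<close> is
  therefore enough, and the final constant depends on \<open>p\<close> alone. The series needs
  \<open>n\<close> to be large against \<open>L\<^sup>2\<close>. Very unlikely messages violate
  this, but for them the trivial bound \<open>2 \<mu>\<close> already has the required form. So one
  estimate holds for every message, and the sum over messages needs no cut-off between typical and
  rare ones, with its loss in \<epsilon>. Private randomness of Alice makes \<open>f\<close>
  fractional instead of an indicator; this is harmless, as only \<open>0 \<le> f \<le> 1\<close>
  enters.\<close>

lemma sum_PiE_insert:
  assumes "i \<notin> I"
  shows "(\<Sum>x\<in>insert i I \<rightarrow>\<^sub>E A. h x) = (\<Sum>a\<in>A. \<Sum>x\<in>I \<rightarrow>\<^sub>E A. h (x(i := a)))"
proof -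
  have "(\<Sum>x\<in>insert i I \<rightarrow>\<^sub>E A. h x) = (\<Sum>z\<in>A \<times> (I \<rightarrow>\<^sub>E A). h (case z of (a, x) \<Rightarrow> x(i := a)))"
    unfolding PiE_insert_eq
    by (subst sum.reindex[OF inj_combinator[OF assms, of "\<lambda>_. A"]]) (simp add: case_prod_unfold)
  also have "\<dots> = (\<Sum>a\<in>A. \<Sum>x\<in>I \<rightarrow>\<^sub>E A. h (x(i := a)))"
    by (simp add: sum.cartesian_product case_prod_unfold)
  finally show ?thesis .
qed

text \<open>The norm for the uniform probability measure on \<open>A\<close>. There is no absolute
  value because the inequalities below concern nonnegative functions.\<close>

definition pnorm :: "real \<Rightarrow> 'a set \<Rightarrow> ('a \<Rightarrow> real) \<Rightarrow> real" where
  "pnorm q A f = ((\<Sum>x\<in>A. f x powr q) / card A) powr (1 / q)"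

lemma pnorm_nonneg [simp]: "pnorm q A f \<ge> 0"
  by (simp add: pnorm_def)

lemma pnorm_powr:
  assumes "q > 0"
  shows "pnorm q A f powr q = (\<Sum>x\<in>A. f x powr q) / card A"
  using assms by (simp add: pnorm_def powr_powr sum_nonneg)

text \<open>Fubini for averages of q-th powers. With the same exponent inside and outside this is an
  equality, so induction over the coordinates loses nothing.\<close>

lemma pnorm_insert:
  assumes "q > 0" "finite I" "i \<notin> I"
  shows "pnorm q (insert i I \<rightarrow>\<^sub>E A) f = pnorm q A (\<lambda>a. pnorm q (I \<rightarrow>\<^sub>E A) (\<lambda>x. f (x(i := a))))"
proof -
  have "pnorm q A (\<lambda>a. pnorm q (I \<rightarrow>\<^sub>E A) (\<lambda>x. f (x(i := a)))) =
     ((\<Sum>a\<in>A. (\<Sum>x\<in>I \<rightarrow>\<^sub>E A. f (x(i := a)) powr q) / card (I \<rightarrow>\<^sub>E A)) / card A) powr (1 / q)"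
    unfolding pnorm_def[of q A] using assms(1) by (simp add: pnorm_powr)
  also have "\<dots> = pnorm q (insert i I \<rightarrow>\<^sub>E A) f"
    unfolding pnorm_def using assms
    by (simp add: sum_PiE_insert card_PiE mult.commute flip: sum_divide_distrib)
  finally show ?thesis ..
qed

text \<open>With two functions instead of one quadratic form the induction needs no Minkowski inequality:
  for a nonnegative kernel, the bound on the remaining coordinates may be inserted pointwise.\<close>

lemma bilinear_tensor_bound:
  fixes k :: "'a \<Rightarrow> 'a \<Rightarrow> real"
  assumes "q > 0" "finite I" "\<And>a b. k a b \<ge> 0"
    and base: "\<And>F G. (\<forall>a\<in>A. F a \<ge> 0) \<Longrightarrow> (\<forall>a\<in>A. G a \<ge> 0) \<Longrightarrow>
      (\<Sum>a\<in>A. \<Sum>b\<in>A. k a b * F a * G b) \<le> pnorm q A F * pnorm q A G"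
    and "\<And>x. x \<in> I \<rightarrow>\<^sub>E A \<Longrightarrow> f x \<ge> 0" "\<And>x. x \<in> I \<rightarrow>\<^sub>E A \<Longrightarrow> g x \<ge> 0"
  shows "(\<Sum>x\<in>I \<rightarrow>\<^sub>E A. \<Sum>y\<in>I \<rightarrow>\<^sub>E A. (\<Prod>i\<in>I. k (x i) (y i)) * f x * g y)
    \<le> pnorm q (I \<rightarrow>\<^sub>E A) f * pnorm q (I \<rightarrow>\<^sub>E A) g"
  using assms(2,5,6)
proof (induction I arbitrary: f g rule: finite_induct)
  case empty
  then show ?case using \<open>q > 0\<close> by (simp add: pnorm_def powr_powr)
next
  case (insert i I)
  let ?X = "I \<rightarrow>\<^sub>E A"
  define F where "F a = pnorm q ?X (\<lambda>x. f (x(i := a)))" for a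
  define G where "G a = pnorm q ?X (\<lambda>x. g (x(i := a)))" for a
  have up: "x(i := a) \<in> insert i I \<rightarrow>\<^sub>E A" if "x \<in> ?X" "a \<in> A" for x a
    using that by (auto simp: PiE_def extensional_def)
  have pr: "(\<Prod>j\<in>insert i I. k ((x(i := a)) j) ((y(i := b)) j)) = k a b * (\<Prod>j\<in>I. k (x j) (y j))"
    for x y a b
  proof -
    have "(\<Prod>j\<in>I. k ((x(i := a)) j) ((y(i := b)) j)) = (\<Prod>j\<in>I. k (x j) (y j))"
      using insert.hyps by (intro prod.cong) auto
    then show ?thesis using insert.hyps by simp
  qed
  have "(\<Sum>x\<in>insert i I \<rightarrow>\<^sub>E A. \<Sum>y\<in>insert i I \<rightarrow>\<^sub>E A. (\<Prod>i\<in>insert i I. k (x i) (y i)) * f x * g y)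
    = (\<Sum>a\<in>A. \<Sum>x\<in>?X. \<Sum>b\<in>A. \<Sum>y\<in>?X. k a b * ((\<Prod>j\<in>I. k (x j) (y j)) * f (x(i := a)) * g (y(i := b))))"
    unfolding sum_PiE_insert[OF insert.hyps(2)] pr by (simp add: mult_ac)
  also have "\<dots> = (\<Sum>a\<in>A. \<Sum>b\<in>A. k a b *
      (\<Sum>x\<in>?X. \<Sum>y\<in>?X. (\<Prod>j\<in>I. k (x j) (y j)) * f (x(i := a)) * g (y(i := b))))"
    by (subst (2) sum.swap) (simp add: sum_distrib_left)
  also have "\<dots> \<le> (\<Sum>a\<in>A. \<Sum>b\<in>A. k a b * (F a * G b))"
    unfolding F_def G_def by (intro sum_mono mult_left_mono insert.IH assms(3) insert.prems up)
  also have "\<dots> \<le> pnorm q A F * pnorm q A G"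
    using base[of F G] by (simp add: F_def G_def mult.assoc)
  also have "\<dots> = pnorm q (insert i I \<rightarrow>\<^sub>E A) f * pnorm q (insert i I \<rightarrow>\<^sub>E A) g"
    unfolding F_def G_def by (simp only: pnorm_insert[OF \<open>q > 0\<close> insert.hyps])
  finally show ?case .
qed

text \<open>To first order in \<delta> the left side is \<open>x + \<delta> * (x * ln x)\<close>, a
  lower bound by \<open>exp y \<ge> 1 + y\<close>. On a bounded interval \<open>x * ln x\<close>
  exceeds its tangent at 1 by a multiple of \<open>(x - 1)\<^sup>2\<close>, which will become a
  variance.\<close>

lemma powr_ge_quadratic:
  fixes x B \<delta> :: real
  assumes "0 \<le> x" "x \<le> B" "0 \<le> \<delta>"
  shows "x powr (1 + \<delta>) \<ge> x + \<delta> * ((x - 1) + (x - 1)\<^sup>2 / (2 * (B + 1)))"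
proof -
  \<comment> \<open>Here \<open>x - 1 = (s - 1) * (s + 1)\<close> with \<open>s = sqrt x\<close>,
    and \<open>(s + 1)\<^sup>2 \<le> 2 * (x + 1)\<close>.\<close>
  have sq: "2 * x - 2 * sqrt x \<ge> (x - 1) + (x - 1)\<^sup>2 / (2 * (B + 1))"
  proof -
    define s where "s = sqrt x"
    have s: "s \<ge> 0" "x = s\<^sup>2" using assms by (auto simp: s_def)
    have "(s + 1)\<^sup>2 \<le> 2 * (B + 1)"
      using assms(2) s zero_le_power2[of "s - 1"] by (simp add: power2_eq_square algebra_simps)
    moreover have "(x - 1)\<^sup>2 = (s - 1)\<^sup>2 * (s + 1)\<^sup>2"
      by (simp add: s(2) power2_eq_square algebra_simps)
    ultimately have "(x - 1)\<^sup>2 \<le> (s - 1)\<^sup>2 * (2 * (B + 1))"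
      by (simp add: mult_left_mono)
    then have "(x - 1)\<^sup>2 / (2 * (B + 1)) \<le> (s - 1)\<^sup>2"
      using assms by (simp add: divide_simps)
    moreover have "sqrt x = s" by (simp add: s_def)
    ultimately show ?thesis unfolding \<open>sqrt x = s\<close> s(2)
      by (simp add: power2_eq_square algebra_simps)
  qed
  show ?thesis
  proof (cases "x = 0")
    case True
    have "1 / (2 * (B + 1)) \<le> 1" using assms by (simp add: divide_simps)
    then have "\<delta> * (- 1 + 1 / (2 * (B + 1))) \<le> 0"
      using assms(3) by (intro mult_nonneg_nonpos) auto
    then show ?thesis using True by simp
  next
    case False
    then have x: "x > 0" using assms by simp
    \<comment> \<open>Applying \<open>ln y \<le> y - 1\<close> to \<open>y = 1 / \<surd>x\<close> rather than \<open>1 / x\<close> keeps a quadratic term: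
      \<open>x ln x \<ge> 2x - 2\<surd>x = (x - 1) + (\<surd>x - 1)\<^sup>2\<close>.\<close>
    have "ln (1 / sqrt x) \<le> 1 / sqrt x - 1" using x by (intro ln_le_minus_one) simp
    then have "ln x \<ge> 2 - 2 / sqrt x" using x by (simp add: ln_div ln_sqrt)
    then have "x * ln x \<ge> x * (2 - 2 / sqrt x)" using x by simp
    also have "x * (2 - 2 / sqrt x) = 2 * x - 2 * sqrt x"
      using x by (simp add: right_diff_distrib) (simp add: field_simps)
    finally have l: "x * ln x \<ge> (x - 1) + (x - 1)\<^sup>2 / (2 * (B + 1))" using sq by simp
    have "x powr (1 + \<delta>) = x * exp (\<delta> * ln x)" using x by (simp add: powr_def distrib_right exp_add)
    also have "\<dots> \<ge> x * (1 + \<delta> * ln x)"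
      using x exp_ge_add_one_self[of "\<delta> * ln x"] by (intro mult_left_mono) auto
    finally have "x powr (1 + \<delta>) \<ge> x + \<delta> * (x * ln x)" by (simp add: algebra_simps)
    then show ?thesis using l mult_left_mono[OF l assms(3)] by linarith
  qed
qed

text \<open>The left side is the squared mean plus \<open>t\<close> times the variance. After
  scaling to mean 1, the linear terms of \<open>powr_ge_quadratic\<close> average out and its
  quadratic terms give \<open>t\<close> times the variance.\<close>

lemma quadratic_le_pnorm:
  fixes F :: "'a \<Rightarrow> real"
  assumes A: "finite A" "A \<noteq> {}" and \<delta>: "0 < \<delta>" "\<delta> \<le> 1" and F: "\<forall>a\<in>A. F a \<ge> 0"
    and t: "t = \<delta> / (2 * (real (card A) + 1))"
  shows "(1 - t) * ((\<Sum>a\<in>A. F a) / card A)\<^sup>2 + t * ((\<Sum>a\<in>A. (F a)\<^sup>2) / card A)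
    \<le> (pnorm (1 + \<delta>) A F)\<^sup>2"
proof -
  define N where "N = real (card A)"
  have N: "N > 0" using A by (simp add: N_def card_gt_0_iff)
  define M where "M = (\<Sum>a\<in>A. F a) / N"
  show ?thesis
  proof (cases "M = 0")
    case True
    then have "\<forall>a\<in>A. F a = 0"
      using A F N by (simp add: M_def sum_nonneg_eq_0_iff)
    then show ?thesis by (simp add: pnorm_def)
  next
    case False
    then have M: "M > 0" using N F sum_nonneg[of A F] by (simp add: M_def less_le)
    define q where "q = 1 + \<delta>"
    define x where "x a = F a / M" for a
    define Q where "Q = (\<Sum>a\<in>A. x a powr q) / N"
    have sx: "(\<Sum>a\<in>A. x a) = N"
    proof -
      have "(\<Sum>a\<in>A. x a) = (\<Sum>a\<in>A. F a) / M" by (simp add: x_def sum_divide_distrib)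
      also have "(\<Sum>a\<in>A. F a) = M * N" using N by (simp add: M_def)
      finally show ?thesis using M by simp
    qed
    have x0: "x a \<ge> 0" if "a \<in> A" for a using that F M by (simp add: x_def)
    \<comment> \<open>The alphabet size enters here: a nonnegative function of mean 1 is bounded by
      \<open>N\<close>. Taking \<open>B = N\<close> explains the denominator of
      \<open>t\<close>.\<close>
    have xN: "x a \<le> N" if "a \<in> A" for a
      using member_le_sum[of a A x] that A x0 sx by simp
    have "(\<Sum>a\<in>A. x a powr q) \<ge> (\<Sum>a\<in>A. x a + \<delta> * ((x a - 1) + (x a - 1)\<^sup>2 / (2 * (N + 1))))"
      unfolding q_def using x0 xN \<delta> by (intro sum_mono powr_ge_quadratic) auto
    also have "(\<Sum>a\<in>A. x a + \<delta> * ((x a - 1) + (x a - 1)\<^sup>2 / (2 * (N + 1)))) =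
       (\<Sum>a\<in>A. (1 - 2 * t + \<delta>) * x a + (t - \<delta>) + t * (x a)\<^sup>2)"
    proof (intro sum.cong refl)
      fix a
      have "\<delta> * ((x a - 1)\<^sup>2 / (2 * (N + 1))) = t * (x a - 1)\<^sup>2" by (simp add: t N_def)
      then show "x a + \<delta> * ((x a - 1) + (x a - 1)\<^sup>2 / (2 * (N + 1))) =
          (1 - 2 * t + \<delta>) * x a + (t - \<delta>) + t * (x a)\<^sup>2"
        unfolding distrib_left by (simp add: algebra_simps power2_eq_square)
    qed
    also have "\<dots> = (1 - 2 * t + \<delta>) * N + N * (t - \<delta>) + t * (\<Sum>a\<in>A. (x a)\<^sup>2)"
      by (simp add: sum.distrib sx flip: sum_distrib_left) (simp add: N_def)
    also have "\<dots> = N * (1 - t) + t * (\<Sum>a\<in>A. (x a)\<^sup>2)" by (simp add: algebra_simps)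
    finally have "N * (1 - t) + t * (\<Sum>a\<in>A. (x a)\<^sup>2) \<le> (\<Sum>a\<in>A. x a powr q)" .
    then have Q1: "Q \<ge> (1 - t) + t * ((\<Sum>a\<in>A. (x a)\<^sup>2) / N)"
    proof -
      have "(1 - t) + t * ((\<Sum>a\<in>A. (x a)\<^sup>2) / N) = (N * (1 - t) + t * (\<Sum>a\<in>A. (x a)\<^sup>2)) / N"
        using N by (simp add: add_divide_distrib)
      with \<open>N * (1 - t) + t * (\<Sum>a\<in>A. (x a)\<^sup>2) \<le> (\<Sum>a\<in>A. x a powr q)\<close> show ?thesis
        using N by (simp add: Q_def divide_right_mono)
    qed
    have t0: "t \<ge> 0" using \<delta> by (simp add: t)
    have "(\<Sum>a\<in>A. 1 * x a)\<^sup>2 \<le> (\<Sum>a\<in>A. 1\<^sup>2) * (\<Sum>a\<in>A. (x a)\<^sup>2)"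
      by (rule Cauchy_Schwarz_ineq_sum)
    then have "N\<^sup>2 \<le> N * (\<Sum>a\<in>A. (x a)\<^sup>2)" by (simp add: sx N_def)
    then have "(\<Sum>a\<in>A. (x a)\<^sup>2) / N \<ge> 1" using N by (simp add: power2_eq_square)
    then have "t * ((\<Sum>a\<in>A. (x a)\<^sup>2) / N) \<ge> t" using t0 mult_left_mono by fastforce
    with Q1 have Qge: "Q \<ge> 1" by simp
    \<comment> \<open>The squared norm is \<open>Q powr (2 / q)\<close>, and
      \<open>q \<le> 2\<close> makes the exponent at least 1.\<close>
    have "Q = Q powr 1" using Qge by simp
    also have "\<dots> \<le> Q powr (2 / q)"
      using Qge \<delta> by (intro powr_mono) (auto simp: q_def)
    also have "\<dots> = (pnorm q A x)\<^sup>2"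
      unfolding pnorm_def Q_def[symmetric] N_def[symmetric]
      by (simp add: power2_eq_square flip: powr_add)
    finally have 1: "(1 - t) + t * ((\<Sum>a\<in>A. (x a)\<^sup>2) / N) \<le> (pnorm q A x)\<^sup>2" using Q1 by simp
    have pn: "pnorm q A F = M * pnorm q A x"
    proof -
      have "(\<Sum>a\<in>A. F a powr q) = (\<Sum>a\<in>A. M powr q * x a powr q)"
        using M F by (intro sum.cong refl) (simp add: x_def powr_divide)
      then have "(\<Sum>a\<in>A. F a powr q) / N = M powr q * Q"
        by (simp add: Q_def flip: sum_distrib_left)
      then show ?thesis using M Qge \<delta>
        by (simp add: pnorm_def N_def[symmetric] Q_def[symmetric] powr_mult powr_powr)
          (simp add: q_def)
    qed
    have "(1 - t) * M\<^sup>2 + t * ((\<Sum>a\<in>A. (F a)\<^sup>2) / N) = M\<^sup>2 * ((1 - t) + t * ((\<Sum>a\<in>A. (x a)\<^sup>2) / N))"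
      using M by (simp add: x_def power_divide distrib_left flip: sum_divide_distrib)
    also have "\<dots> \<le> M\<^sup>2 * (pnorm q A x)\<^sup>2" by (intro mult_left_mono 1) simp
    finally show ?thesis unfolding pn q_def[symmetric] by (simp add: power_mult_distrib power_divide M_def N_def)
  qed
qed

text \<open>For \<open>p\<close> the size of the alphabet, the joint law of a uniform \<open>a\<close> and a copy \<open>b\<close> that is
  resampled with probability \<open>1 - t\<close>.\<close>

definition noise_kernel :: "real \<Rightarrow> nat \<Rightarrow> 'a \<Rightarrow> 'a \<Rightarrow> real" where
  "noise_kernel t p a b = (1 - t + t * (if a = b then real p else 0)) / (real p)\<^sup>2"

lemma noise_kernel_bilinear:
  assumes "finite A"
  shows "(\<Sum>a\<in>A. \<Sum>b\<in>A. noise_kernel t (card A) a b * F a * G b) =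
    (1 - t) * (((\<Sum>a\<in>A. F a) / card A) * ((\<Sum>a\<in>A. G a) / card A)) + t * ((\<Sum>a\<in>A. F a * G a) / card A)"
proof -
  define N where "N = real (card A)"
  have "(\<Sum>a\<in>A. \<Sum>b\<in>A. noise_kernel t (card A) a b * F a * G b) =
    (\<Sum>a\<in>A. \<Sum>b\<in>A. (1 - t) / N\<^sup>2 * (F a * G b) + (if a = b then t * N / N\<^sup>2 * (F a * G b) else 0))"
    by (intro sum.cong refl) (auto simp: noise_kernel_def N_def add_divide_distrib diff_divide_distrib algebra_simps)
  also have "\<dots> = (1 - t) / N\<^sup>2 * ((\<Sum>a\<in>A. F a) * (\<Sum>b\<in>A. G b)) + t * N / N\<^sup>2 * (\<Sum>a\<in>A. F a * G a)"
  proof -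
    have "(\<Sum>a\<in>A. \<Sum>b\<in>A. (1 - t) / N\<^sup>2 * (F a * G b)) = (1 - t) / N\<^sup>2 * ((\<Sum>a\<in>A. F a) * (\<Sum>b\<in>A. G b))"
      by (simp only: sum_product) (simp only: sum_distrib_left)
    moreover have "(\<Sum>a\<in>A. \<Sum>b\<in>A. if a = b then t * N / N\<^sup>2 * (F a * G b) else 0)
        = t * N / N\<^sup>2 * (\<Sum>a\<in>A. F a * G a)"
      using assms by (simp add: sum_distrib_left)
    ultimately show ?thesis by (simp only: sum.distrib)
  qed
  also have "\<dots> = (1 - t) * (((\<Sum>a\<in>A. F a) / N) * ((\<Sum>a\<in>A. G a) / N)) + t * ((\<Sum>a\<in>A. F a * G a) / N)"
    by (simp add: power2_eq_square)
  finally show ?thesis unfolding N_def .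
qed

text \<open>The form is positive semidefinite for \<open>0 \<le> t \<le> 1\<close>, so
  Cauchy-Schwarz reduces it to the diagonal case \<open>quadratic_le_pnorm\<close>.\<close>

lemma noise_kernel_le_pnorm:
  fixes F G :: "'a \<Rightarrow> real"
  assumes A: "finite A" "A \<noteq> {}" and \<delta>: "0 < \<delta>" "\<delta> \<le> 1"
    and F: "\<forall>a\<in>A. F a \<ge> 0" and G: "\<forall>a\<in>A. G a \<ge> 0"
    and t: "t = \<delta> / (2 * (real (card A) + 1))"
  shows "(\<Sum>a\<in>A. \<Sum>b\<in>A. noise_kernel t (card A) a b * F a * G b)
    \<le> pnorm (1 + \<delta>) A F * pnorm (1 + \<delta>) A G"
proof -
  define N where "N = real (card A)"
  have N: "N > 0" using A by (simp add: N_def card_gt_0_iff)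
  have t01: "0 \<le> t" "t \<le> 1" using \<delta> by (auto simp: t divide_simps)
  define a where "a = (\<Sum>a\<in>A. F a) / N"
  define b where "b = (\<Sum>a\<in>A. G a) / N"
  define c where "c = (\<Sum>a\<in>A. (F a)\<^sup>2) / N"
  define d where "d = (\<Sum>a\<in>A. (G a)\<^sup>2) / N"
  define e where "e = (\<Sum>a\<in>A. F a * G a) / N"
  define P where "P = pnorm (1 + \<delta>) A F"
  define R where "R = pnorm (1 + \<delta>) A G"
  have nn: "a \<ge> 0" "b \<ge> 0" "c \<ge> 0" "d \<ge> 0" "P \<ge> 0" "R \<ge> 0"
    using N F G by (auto simp: a_def b_def c_def d_def P_def R_def intro!: sum_nonneg divide_nonneg_nonneg)
  have F2: "(1 - t) * a\<^sup>2 + t * c \<le> P\<^sup>2"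
    unfolding a_def c_def P_def N_def by (rule quadratic_le_pnorm) fact+
  have G2: "(1 - t) * b\<^sup>2 + t * d \<le> R\<^sup>2"
    unfolding b_def d_def R_def N_def by (rule quadratic_le_pnorm) fact+
  have "(\<Sum>a\<in>A. F a * G a)\<^sup>2 \<le> (\<Sum>a\<in>A. (F a)\<^sup>2) * (\<Sum>a\<in>A. (G a)\<^sup>2)"
    by (rule Cauchy_Schwarz_ineq_sum)
  then have e2: "e\<^sup>2 \<le> c * d" using N by (simp add: e_def c_def d_def power_divide power2_eq_square divide_right_mono)
  have "e \<le> sqrt c * sqrt d" using real_le_rsqrt[OF e2] by (simp add: real_sqrt_mult)
  then have le: "(1 - t) * (a * b) + t * e \<le> (1 - t) * (a * b) + t * (sqrt c * sqrt d)"
    using t01 by (simp add: mult_left_mono)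
  \<comment> \<open>Square roots of the two weights turn the bound into an inner product in the
    plane, with coordinates indexed by \<open>bool\<close>.\<close>
  obtain \<alpha> \<beta> where ab: "\<alpha>\<^sup>2 = 1 - t" "\<beta>\<^sup>2 = t"
    using t01 by (metis diff_ge_0_iff_ge real_sqrt_pow2)
  obtain c' d' where cd: "c' = sqrt c" "d' = sqrt d" "c'\<^sup>2 = c" "d'\<^sup>2 = d" using nn by simp
  define v where "v = (\<lambda>i. if i then \<alpha> * a else \<beta> * c')"
  define w where "w = (\<lambda>i. if i then \<alpha> * b else \<beta> * d')"
  have "(\<Sum>i\<in>UNIV. v i * w i)\<^sup>2 \<le> (\<Sum>i\<in>UNIV. (v i)\<^sup>2) * (\<Sum>i\<in>UNIV. (w i)\<^sup>2)"
    by (rule Cauchy_Schwarz_ineq_sum)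
  also have "(\<Sum>i\<in>UNIV. (v i)\<^sup>2) = (1 - t) * a\<^sup>2 + t * c"
    by (simp add: UNIV_bool v_def power_mult_distrib ab cd(3,4))
  also have "(\<Sum>i\<in>UNIV. (w i)\<^sup>2) = (1 - t) * b\<^sup>2 + t * d"
    by (simp add: UNIV_bool w_def power_mult_distrib ab cd(3,4))
  also have "(\<Sum>i\<in>UNIV. v i * w i) = \<alpha>\<^sup>2 * (a * b) + \<beta>\<^sup>2 * (c' * d')"
    by (simp add: UNIV_bool v_def w_def power2_eq_square)
  also have "\<dots> = (1 - t) * (a * b) + t * (sqrt c * sqrt d)" by (simp only: ab cd(1,2))
  finally have "((1 - t) * (a * b) + t * (sqrt c * sqrt d))\<^sup>2 \<le> ((1 - t) * a\<^sup>2 + t * c) * ((1 - t) * b\<^sup>2 + t * d)" .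
  also have "\<dots> \<le> P\<^sup>2 * R\<^sup>2" using F2 G2 nn t01 by (intro mult_mono) auto
  finally have "((1 - t) * (a * b) + t * (sqrt c * sqrt d))\<^sup>2 \<le> (P * R)\<^sup>2" by (simp add: power_mult_distrib)
  then have "(1 - t) * (a * b) + t * (sqrt c * sqrt d) \<le> P * R"
    by (rule power2_le_imp_le) (simp add: nn)
  with le have "(1 - t) * (a * b) + t * e \<le> P * R" by (rule order_trans)
  then show ?thesis
    by (simp only: noise_kernel_bilinear[OF A(1)] a_def b_def e_def P_def R_def N_def)
qed

text \<open>Hypercontractivity as noise stability: the left side is the expectation of
  \<open>f x * f y\<close> for a correlated pair, and its Fourier expansion damps the characters of
  support size \<open>k\<close> by \<open>t ^ k\<close>.\<close>

lemma noise_stability_le_pnorm: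
  fixes f :: "('i \<Rightarrow> 'a) \<Rightarrow> real"
  assumes "finite I" "finite A" "A \<noteq> {}" "0 < \<delta>" "\<delta> \<le> 1"
    and t: "t = \<delta> / (2 * (real (card A) + 1))" and "\<And>x. x \<in> I \<rightarrow>\<^sub>E A \<Longrightarrow> f x \<ge> 0"
  shows "(\<Sum>x\<in>I \<rightarrow>\<^sub>E A. \<Sum>y\<in>I \<rightarrow>\<^sub>E A. (\<Prod>i\<in>I. noise_kernel t (card A) (x i) (y i)) * f x * f y)
    \<le> (pnorm (1 + \<delta>) (I \<rightarrow>\<^sub>E A) f)\<^sup>2"
proof -
  have "t \<le> 1" "t \<ge> 0" using assms by (auto simp: t divide_simps)
  then have "noise_kernel t (card A) a b \<ge> 0" for a b :: 'a
    by (auto simp: noise_kernel_def)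
  moreover have "(\<Sum>a\<in>A. \<Sum>b\<in>A. noise_kernel t (card A) a b * F a * G b)
      \<le> pnorm (1 + \<delta>) A F * pnorm (1 + \<delta>) A G"
    if "\<forall>a\<in>A. F a \<ge> 0" "\<forall>a\<in>A. G a \<ge> 0" for F G :: "'a \<Rightarrow> real"
    by (rule noise_kernel_le_pnorm) (use assms that in blast)+
  ultimately show ?thesis unfolding power2_eq_square
    using \<open>0 < \<delta>\<close> \<open>finite I\<close> assms(7) by (intro bilinear_tensor_bound) auto
qed

section \<open>Fourier weights modulo p\<close>

definition rootu :: "nat \<Rightarrow> complex" where
  "rootu p = cis (2 * pi / real p)"

lemma norm_rootu [simp]: "cmod (rootu p) = 1"
  by (simp add: rootu_def)

lemma rootu_power_eq_iff:
  assumes "p \<ge> 1"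
  shows "rootu p ^ m = rootu p ^ n \<longleftrightarrow> m mod p = n mod p"
proof -
  have "rootu p ^ k = exp (2 * of_real pi * \<i> * of_nat k / of_nat p)" for k
    unfolding rootu_def Complex.DeMoivre by (simp add: cis_conv_exp mult_ac)
  then show ?thesis using complex_root_unity_eq[OF assms, of m n] by simp
qed

text \<open>Orthogonality of characters without the trivial one; the omitted frequency
  \<open>s = 0\<close> accounts for the \<open>- 1\<close>.\<close>

lemma sum_rootu:
  assumes "p \<ge> 1"
  shows "(\<Sum>s\<in>{1..<p}. rootu p ^ (s * m) * cnj (rootu p ^ (s * n)))
    = of_real ((if m mod p = n mod p then real p else 0) - 1)"
proof -
  define z where "z = rootu p ^ m * cnj (rootu p ^ n)"
  have u: "rootu p ^ n * cnj (rootu p ^ n) = 1" for n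
    by (metis complex_norm_square norm_power norm_rootu of_real_1 power_one)
  have z1: "z = 1 \<longleftrightarrow> m mod p = n mod p"
  proof -
    have "z = 1 \<longleftrightarrow> rootu p ^ m = rootu p ^ n"
    proof
      assume "z = 1"
      have "rootu p ^ m = rootu p ^ m * (rootu p ^ n * cnj (rootu p ^ n))" by (simp only: u mult_1_right)
      also have "\<dots> = z * rootu p ^ n" by (simp only: z_def mult_ac)
      finally show "rootu p ^ m = rootu p ^ n" using \<open>z = 1\<close> by simp
    qed (use u[of n] in \<open>simp add: z_def\<close>)
    then show ?thesis using rootu_power_eq_iff[OF assms] by simp
  qed
  have "z ^ p = 1"
  proof -
    have "rootu p ^ p = rootu p ^ 0" using assms by (subst rootu_power_eq_iff) auto
    then have "rootu p ^ p = 1" by simp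
    then have "(rootu p ^ p) ^ m * cnj ((rootu p ^ p) ^ n) = 1" by simp
    then show ?thesis by (simp add: z_def power_mult_distrib mult.commute flip: power_mult)
  qed
  then have s: "(\<Sum>s<p. z ^ s) = (if m mod p = n mod p then of_nat p else 0)"
    using z1 geometric_sum[of z p] by auto
  have "(\<Sum>s\<in>{1..<p}. rootu p ^ (s * m) * cnj (rootu p ^ (s * n))) = (\<Sum>s\<in>{1..<p}. z ^ s)"
    by (intro sum.cong refl) (simp add: z_def power_mult_distrib mult.commute flip: power_mult)
  also have "\<dots> = (\<Sum>s<p. z ^ s) - 1"
    using assms by (simp add: lessThan_atLeast0 sum.atLeast_Suc_lessThan)
  finally show ?thesis unfolding s by simp
qed

definition fcoef ::
  "nat \<Rightarrow> 'x set \<Rightarrow> ('j \<Rightarrow> 'x \<Rightarrow> nat) \<Rightarrow> 'j set \<Rightarrow> ('x \<Rightarrow> real) \<Rightarrow> ('j \<Rightarrow> nat) \<Rightarrow> complex" where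
  "fcoef p X a J f s = (\<Sum>x\<in>X. of_real (f x) * (\<Prod>j\<in>J. rootu p ^ (s j * a j x))) / of_nat (card X)"

text \<open>Only frequencies with no vanishing entry are summed. For \<open>a i x = x i\<close> this is the Fourier
  weight of \<open>f\<close> on the characters with support \<open>J\<close>; for \<open>J\<close> a set of edges and \<open>a e x\<close> the sum of
  \<open>x\<close> over \<open>e\<close>, the frequencies are the vectors \<open>M\<^sup>T s\<close>.\<close>

definition fweight ::
  "nat \<Rightarrow> 'x set \<Rightarrow> ('j \<Rightarrow> 'x \<Rightarrow> nat) \<Rightarrow> 'j set \<Rightarrow> ('x \<Rightarrow> real) \<Rightarrow> real" where
  "fweight p X a J f = (\<Sum>s\<in>J \<rightarrow>\<^sub>E {1..<p}. (cmod (fcoef p X a J f s))\<^sup>2)"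

lemma fweight_nonneg: "fweight p X a J f \<ge> 0"
  by (simp add: fweight_def sum_nonneg)

text \<open>The full character sum over all \<open>p\<close> frequencies. Hence
  \<open>agree p m n - 1\<close> is the kernel of the nontrivial ones.\<close>

definition agree :: "nat \<Rightarrow> nat \<Rightarrow> nat \<Rightarrow> real" where
  "agree p m n = (if m mod p = n mod p then real p else 0)"

text \<open>Expanding the squared modulus gives pairs \<open>x\<close>, \<open>y\<close>; the sum
  over frequencies then factorises over \<open>J\<close>, which leaves a purely real double
  sum.\<close>

lemma fweight_eq:
  assumes "p \<ge> 1" "finite J"
  shows "fweight p X a J f =
    (\<Sum>x\<in>X. \<Sum>y\<in>X. f x * f y * (\<Prod>j\<in>J. agree p (a j x) (a j y) - 1)) / (real (card X))\<^sup>2"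
proof -
  let ?S = "J \<rightarrow>\<^sub>E {1..<p}"
  let ?N = "of_nat (card X) :: complex"
  let ?u = "\<lambda>s x. (\<Prod>j\<in>J. rootu p ^ (s j * a j x))"
  have sq: "of_real ((cmod (fcoef p X a J f s))\<^sup>2) =
     (\<Sum>x\<in>X. \<Sum>y\<in>X. of_real (f x * f y) * (?u s x * cnj (?u s y))) / ?N\<^sup>2" for s
  proof -
    have "of_real ((cmod (fcoef p X a J f s))\<^sup>2) = fcoef p X a J f s * cnj (fcoef p X a J f s)"
      by (rule complex_norm_square)
    also have "\<dots> = (\<Sum>x\<in>X. of_real (f x) * ?u s x) * (\<Sum>y\<in>X. cnj (of_real (f y) * ?u s y)) / ?N\<^sup>2"
      unfolding fcoef_def by (simp add: power2_eq_square)
    finally show ?thesis by (simp add: sum_product mult_ac)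
  qed
  have "of_real (fweight p X a J f) =
     (\<Sum>s\<in>?S. \<Sum>x\<in>X. \<Sum>y\<in>X. of_real (f x * f y) * (?u s x * cnj (?u s y))) / ?N\<^sup>2"
    unfolding fweight_def of_real_sum sq by (simp add: sum_divide_distrib)
  also have "(\<Sum>s\<in>?S. \<Sum>x\<in>X. \<Sum>y\<in>X. of_real (f x * f y) * (?u s x * cnj (?u s y))) =
     (\<Sum>x\<in>X. \<Sum>y\<in>X. of_real (f x * f y) * (\<Sum>s\<in>?S. ?u s x * cnj (?u s y)))"
    by (subst sum.swap, rule sum.cong[OF refl], subst sum.swap) (simp add: sum_distrib_left)
  also have "\<dots> = (\<Sum>x\<in>X. \<Sum>y\<in>X. of_real (f x * f y * (\<Prod>j\<in>J. agree p (a j x) (a j y) - 1)))"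
  proof (intro sum.cong refl)
    fix x y
    have "(\<Sum>s\<in>?S. ?u s x * cnj (?u s y)) =
       (\<Sum>s\<in>?S. \<Prod>j\<in>J. rootu p ^ (s j * a j x) * cnj (rootu p ^ (s j * a j y)))"
      by (simp add: prod.distrib)
    also have "\<dots> = (\<Prod>j\<in>J. \<Sum>s\<in>{1..<p}. rootu p ^ (s * a j x) * cnj (rootu p ^ (s * a j y)))"
      using assms(2) by (subst prod_sum_PiE) auto
    also have "\<dots> = of_real (\<Prod>j\<in>J. agree p (a j x) (a j y) - 1)"
      by (simp only: sum_rootu[OF assms(1)] agree_def of_real_prod)
    finally show "of_real (f x * f y) * (\<Sum>s\<in>?S. ?u s x * cnj (?u s y)) =
        complex_of_real (f x * f y * (\<Prod>j\<in>J. agree p (a j x) (a j y) - 1))" by simp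
  qed
  finally have "complex_of_real (fweight p X a J f) = of_real ((\<Sum>x\<in>X. \<Sum>y\<in>X. f x * f y *
      (\<Prod>j\<in>J. agree p (a j x) (a j y) - 1)) / (real (card X))\<^sup>2)"
    by simp
  then show ?thesis by (simp only: of_real_eq_iff)
qed

lemma prod_affine_expand:
  fixes t :: real
  assumes "finite J"
  shows "(\<Prod>j\<in>J. 1 + t * b j) = (\<Sum>E\<in>Pow J. t ^ card E * (\<Prod>j\<in>E. b j))"
proof -
  have "(\<Prod>j\<in>J. 1 + t * b j) = (\<Sum>E\<in>Pow J. (\<Prod>j\<in>E. t * b j) * (\<Prod>j\<in>J - E. 1))"
    using prod_add[OF assms, of "\<lambda>j. t * b j" "\<lambda>j. 1"] by (simp add: add.commute)
  then show ?thesis by (simp add: prod.distrib)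
qed

text \<open>A generating function in \<open>t\<close> that is used in two ways: at
  \<open>t = 1\<close> the factors collapse to \<open>agree\<close> and the identity is Parseval,
  while for small \<open>t\<close> they are noise kernels up to normalisation.\<close>

lemma sum_fweight:
  assumes "p \<ge> 1" "finite J"
  shows "(\<Sum>E\<in>Pow J. t ^ card E * fweight p X a E f) =
    (\<Sum>x\<in>X. \<Sum>y\<in>X. f x * f y * (\<Prod>j\<in>J. 1 + t * (agree p (a j x) (a j y) - 1))) / (real (card X))\<^sup>2"
proof -
  have "(\<Sum>E\<in>Pow J. t ^ card E * fweight p X a E f) = (\<Sum>E\<in>Pow J. 
     (\<Sum>x\<in>X. \<Sum>y\<in>X. f x * f y * (t ^ card E * (\<Prod>j\<in>E. agree p (a j x) (a j y) - 1))) / (real (card X))\<^sup>2)"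
    using assms
    by (intro sum.cong refl) (auto simp: fweight_eq finite_subset sum_distrib_left mult_ac)
  also have "\<dots> = (\<Sum>x\<in>X. \<Sum>y\<in>X. f x * f y * (\<Prod>j\<in>J. 1 + t * (agree p (a j x) (a j y) - 1))) / (real (card X))\<^sup>2"
    unfolding prod_affine_expand[OF assms(2)] sum_divide_distrib[symmetric] sum_distrib_left
    by (subst sum.swap, rule arg_cong[where f = "\<lambda>z. z / _"], rule sum.cong[OF refl], subst sum.swap) simp
  finally show ?thesis .
qed

lemma fweight_empty:
  "fweight p X a {} f = ((\<Sum>x\<in>X. f x) / card X)\<^sup>2"
proof -
  have "fcoef p X a {} f s = of_real ((\<Sum>x\<in>X. f x) / card X)" for s
    by (simp add: fcoef_def)
  then show ?thesis unfolding fweight_def by (simp only: norm_of_real power2_abs) simp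
qed

section \<open>The level inequality\<close>

definition level_weight :: "nat \<Rightarrow> 'i set \<Rightarrow> (('i \<Rightarrow> nat) \<Rightarrow> real) \<Rightarrow> 'i set \<Rightarrow> real" where
  "level_weight p I f T = fweight p (Zvec p I) (\<lambda>i x. x i) T f"

lemma level_weight_nonneg: "level_weight p I f T \<ge> 0"
  by (simp add: level_weight_def fweight_nonneg)

lemma finite_Zvec [simp]: "finite I \<Longrightarrow> finite (Zvec p I)"
  by (simp add: Zvec_def finite_PiE)

lemma card_Zvec: "finite I \<Longrightarrow> card (Zvec p I) = p ^ card I"
  by (simp add: Zvec_def card_PiE)

lemma Zvec_nonempty: "p \<ge> 1 \<Longrightarrow> Zvec p I \<noteq> {}"
  by (simp add: Zvec_def PiE_eq_empty_iff)

lemma agree_Zvec: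
  assumes "x \<in> Zvec p I" "y \<in> Zvec p I" "i \<in> I"
  shows "agree p (x i) (y i) = (if x i = y i then real p else 0)"
proof -
  have "x i < p" "y i < p" using assms by (auto simp: Zvec_def PiE_iff)
  then show ?thesis by (simp add: agree_def)
qed

text \<open>Divided by \<open>p\<^sup>2\<close>, each factor of \<open>sum_fweight\<close> is a
  noise kernel, so noise stability applies. Since \<open>f \<le> 1\<close>, the power
  \<open>1 + \<delta>\<close> may then be dropped inside the norm, leaving the mean.\<close>

lemma sum_level_weight_le:
  assumes "p \<ge> 1" "finite I" "0 < \<delta>" "\<delta> \<le> 1" and t: "t = \<delta> / (2 * (real p + 1))"
    and f: "\<And>x. x \<in> Zvec p I \<Longrightarrow> 0 \<le> f x \<and> f x \<le> 1"
  shows "(\<Sum>T\<in>Pow I. t ^ card T * level_weight p I f T)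
    \<le> ((\<Sum>x\<in>Zvec p I. f x) / card (Zvec p I)) powr (2 / (1 + \<delta>))"
proof -
  let ?X = "Zvec p I"
  have c: "(real (card ?X))\<^sup>2 = (\<Prod>i\<in>I. (real p)\<^sup>2)"
    using assms(2) by (simp add: card_Zvec mult.commute flip: power_mult)
  have "(\<Sum>T\<in>Pow I. t ^ card T * level_weight p I f T) =
    (\<Sum>x\<in>?X. \<Sum>y\<in>?X. f x * f y * (\<Prod>i\<in>I. 1 + t * (agree p (x i) (y i) - 1)) / (real (card ?X))\<^sup>2)"
    unfolding level_weight_def sum_fweight[OF assms(1,2)] by (simp add: sum_divide_distrib)
  also have "\<dots> = (\<Sum>x\<in>?X. \<Sum>y\<in>?X. (\<Prod>i\<in>I. noise_kernel t p (x i) (y i)) * f x * f y)"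
  proof (intro sum.cong refl)
    fix x y assume xy: "x \<in> ?X" "y \<in> ?X"
    have "(\<Prod>i\<in>I. 1 + t * (agree p (x i) (y i) - 1)) / (real (card ?X))\<^sup>2 =
      (\<Prod>i\<in>I. (1 + t * (agree p (x i) (y i) - 1)) / (real p)\<^sup>2)"
      unfolding c by (simp only: prod_dividef)
    also have "\<dots> = (\<Prod>i\<in>I. noise_kernel t p (x i) (y i))"
      by (intro prod.cong refl) (simp add: agree_Zvec[OF xy] noise_kernel_def algebra_simps)
    finally show "f x * f y * (\<Prod>i\<in>I. 1 + t * (agree p (x i) (y i) - 1)) / (real (card ?X))\<^sup>2
      = (\<Prod>i\<in>I. noise_kernel t p (x i) (y i)) * f x * f y"
      unfolding times_divide_eq_right[symmetric] by (simp only: mult_ac)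
  qed
  also have "\<dots> \<le> (pnorm (1 + \<delta>) ?X f)\<^sup>2"
    using noise_stability_le_pnorm[of I "{0..<p}" \<delta> t f] assms by (simp add: Zvec_def)
  also have "\<dots> = ((\<Sum>x\<in>?X. f x powr (1 + \<delta>)) / card ?X) powr (2 / (1 + \<delta>))"
    unfolding pnorm_def by (simp add: power2_eq_square flip: powr_add)
  also have "\<dots> \<le> ((\<Sum>x\<in>?X. f x) / card ?X) powr (2 / (1 + \<delta>))"
  proof (intro powr_mono2 divide_right_mono sum_mono)
    fix x assume "x \<in> ?X"
    then have "0 \<le> f x" "f x \<le> 1" using f by auto
    then show "f x powr (1 + \<delta>) \<le> f x"
      using powr_mono'[of 1 "1 + \<delta>" "f x"] assms(3) by simp
  qed (use assms(3) in \<open>auto intro!: divide_nonneg_nonneg sum_nonneg\<close>)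
  finally show ?thesis .
qed

lemma sum_level_weight:
  assumes "p \<ge> 1" "finite I"
  shows "(\<Sum>T\<in>Pow I. level_weight p I f T) = (\<Sum>x\<in>Zvec p I. (f x)\<^sup>2) / card (Zvec p I)"
proof -
  let ?X = "Zvec p I"
  have pr: "(\<Prod>i\<in>I. agree p (x i) (y i)) = (if x = y then real (card ?X) else 0)"
    if xy: "x \<in> ?X" "y \<in> ?X" for x y
  proof (cases "x = y")
    case True
    then show ?thesis using xy assms(2) by (simp add: agree_def card_Zvec)
  next
    case False
    then obtain i where "i \<in> I" "x i \<noteq> y i"
      using xy unfolding Zvec_def by (metis PiE_ext)
    then show ?thesis using False assms(2) agree_Zvec[OF xy] by (auto intro!: prod_zero)
  qed
  have "(\<Sum>T\<in>Pow I. level_weight p I f T) = (\<Sum>T\<in>Pow I. 1 ^ card T * fweight p ?X (\<lambda>i x. x i) T f)"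
    by (simp add: level_weight_def)
  also have "\<dots> = (\<Sum>x\<in>?X. \<Sum>y\<in>?X. f x * f y * (\<Prod>i\<in>I. agree p (x i) (y i))) / (real (card ?X))\<^sup>2"
    unfolding sum_fweight[OF assms] by simp
  also have "(\<Sum>x\<in>?X. \<Sum>y\<in>?X. f x * f y * (\<Prod>i\<in>I. agree p (x i) (y i))) =
     (\<Sum>x\<in>?X. \<Sum>y\<in>?X. if x = y then f x * f y * real (card ?X) else 0)"
    by (intro sum.cong refl) (simp add: pr)
  also have "\<dots> = (\<Sum>x\<in>?X. (f x)\<^sup>2) * real (card ?X)"
    using assms(2) by (simp add: power2_eq_square sum_distrib_right)
  finally show ?thesis by (simp add: power2_eq_square)
qed

lemma level_weight_empty:
  "level_weight p I f {} = ((\<Sum>x\<in>Zvec p I. f x) / card (Zvec p I))\<^sup>2"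
  by (simp add: level_weight_def fweight_empty)

text \<open>The noise parameter is tuned to the level, \<open>\<delta> = k / L\<close> with \<open>L = 1 - ln \<mu>\<close>.\<close>

lemma level_inequality:
  assumes "p \<ge> 1" "finite I"
    and f: "\<And>x. x \<in> Zvec p I \<Longrightarrow> 0 \<le> f x \<and> f x \<le> 1"
    and \<mu>: "\<mu> = (\<Sum>x\<in>Zvec p I. f x) / card (Zvec p I)" "\<mu> > 0"
    and k: "1 \<le> k" "real k \<le> 1 - ln \<mu>"
  shows "(\<Sum>T | T \<subseteq> I \<and> card T = 2 * k. level_weight p I f T)
    \<le> \<mu>\<^sup>2 * (2 * (real p + 1) * exp 1 * (1 - ln \<mu>) / k) ^ (2 * k)"
proof -
  \<comment> \<open>The summand 1 keeps \<open>L\<close> away from 0 when \<mu> is close to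
    1.\<close>
  define L where "L = 1 - ln \<mu>"
  have "(\<Sum>x\<in>Zvec p I. f x) \<le> (\<Sum>x\<in>Zvec p I. 1)" using f by (intro sum_mono) auto
  moreover have "card (Zvec p I) > 0"
    using assms(1,2) Zvec_nonempty[of p I] by (simp add: card_gt_0_iff)
  ultimately have "\<mu> \<le> 1" by (simp add: \<mu>(1) divide_le_eq_1)
  then have ln0: "ln \<mu> \<le> 0" using \<mu>(2) by simp
  then have L: "L \<ge> 1" by (simp add: L_def)
  define \<delta> where "\<delta> = real k / L"
  have \<delta>: "0 < \<delta>" "\<delta> \<le> 1" using k L by (auto simp: \<delta>_def L_def)
  define t where "t = \<delta> / (2 * (real p + 1))"
  have t: "t > 0" using \<delta> by (simp add: t_def)
  let ?W = "\<Sum>T | T \<subseteq> I \<and> card T = 2 * k. level_weight p I f T"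
  have "t ^ (2 * k) * ?W = (\<Sum>T | T \<subseteq> I \<and> card T = 2 * k. t ^ card T * level_weight p I f T)"
    by (simp add: sum_distrib_left)
  also have "\<dots> \<le> (\<Sum>T\<in>Pow I. t ^ card T * level_weight p I f T)"
    using t assms(2) by (intro sum_mono2) (auto simp: level_weight_nonneg)
  also have "\<dots> \<le> \<mu> powr (2 / (1 + \<delta>))"
    unfolding \<mu>(1) by (rule sum_level_weight_le[OF assms(1,2) \<delta> t_def f])
  also have "\<dots> \<le> \<mu>\<^sup>2 * exp (2 * real k)"
  proof -
    \<comment> \<open>The exponent falls short of 2 by at most \<open>2 * \<delta>\<close>, which
      costs a factor at most \<open>exp (2 * \<delta> * L)\<close>. The choice of \<delta> makes
      this \<open>exp (2 * k)\<close>, of the same shape as the factor lost on dividing by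
      \<open>t ^ (2 * k)\<close>.\<close>
    have "2 / (1 + \<delta>) = 2 - 2 * \<delta> / (1 + \<delta>)" using \<delta> by (simp add: field_simps)
    then have e: "2 / (1 + \<delta>) * ln \<mu> = 2 * ln \<mu> + 2 * \<delta> / (1 + \<delta>) * (- ln \<mu>)"
      by (simp only: left_diff_distrib mult_minus_right)
    have "2 * \<delta> / (1 + \<delta>) \<le> 2 * \<delta>" using \<delta> by (simp add: divide_simps)
    then have "2 * \<delta> / (1 + \<delta>) * (- ln \<mu>) \<le> 2 * \<delta> * L"
      using ln0 \<delta> by (intro mult_mono) (auto simp: L_def)
    also have "2 * \<delta> * L = 2 * real k" using L by (simp add: \<delta>_def)
    finally have "2 / (1 + \<delta>) * ln \<mu> \<le> 2 * ln \<mu> + 2 * real k" using e by simp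
    then have "exp (2 / (1 + \<delta>) * ln \<mu>) \<le> exp (2 * ln \<mu>) * exp (2 * real k)"
      by (simp flip: exp_add)
    moreover have "exp (2 * ln \<mu>) = \<mu>\<^sup>2" using \<mu>(2) exp_of_nat_mult[of 2 "ln \<mu>"] by simp
    ultimately show ?thesis using \<mu>(2) by (simp add: powr_def)
  qed
  finally have "t ^ (2 * k) * ?W \<le> \<mu>\<^sup>2 * exp (2 * real k)" .
  then have "?W \<le> \<mu>\<^sup>2 * exp (2 * real k) / t ^ (2 * k)" using t by (simp add: field_simps)
  also have "\<dots> = \<mu>\<^sup>2 * (exp 1 / t) ^ (2 * k)"
    using exp_of_nat_mult[of "2 * k" "1 :: real"] by (simp add: power_divide)
  also have "exp 1 / t = 2 * (real p + 1) * exp 1 * L / k"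
    using L k by (simp add: t_def \<delta>_def)
  finally show ?thesis by (simp only: L_def)
qed

section \<open>Vertex sets covered by a random matching\<close>

lemma partial_matchingsD:
  assumes "G \<in> partial_matchings n m"
  shows "finite G" "card G = m" "pairwise disjnt G" "\<And>e. e \<in> G \<Longrightarrow> e \<subseteq> {1..n}"
    "\<And>e. e \<in> G \<Longrightarrow> finite e" "\<And>e. e \<in> G \<Longrightarrow> card e = 2"
proof -
  show "e \<subseteq> {1..n}" if "e \<in> G" for e using assms that by (auto simp: partial_matchings_def)
  then have "G \<subseteq> Pow {1..n}" by auto
  then show "finite G" by (rule finite_subset) simp
  show "finite e" if "e \<in> G" for e using assms that by (auto simp: partial_matchings_def finite_subset)
qed (use assms in \<open>auto simp: partial_matchings_def\<close>)

lemma finite_partial_matchings [simp]: "finite (partial_matchings n m)"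
  by (rule finite_subset[of _ "Pow (Pow {1..n})"]) (auto simp: partial_matchings_def)

lemma partial_matchings_nonempty:
  assumes "2 * m \<le> n"
  shows "partial_matchings n m \<noteq> {}"
proof -
  \<comment> \<open>Consecutive pairs, shifted by one because the vertices start at 1.\<close>
  let ?e = "\<lambda>i. {2 * i + 1, 2 * i + 2}"
  have inj: "inj_on ?e {..<m}" by (intro inj_onI) (auto simp: doubleton_eq_iff)
  have "?e ` {..<m} \<in> partial_matchings n m"
    unfolding partial_matchings_def
  proof (intro CollectI conjI)
    show "\<forall>e\<in>?e ` {..<m}. e \<subseteq> {1..n} \<and> card e = 2" using assms by auto
    show "pairwise disjnt (?e ` {..<m})"
      by (auto simp: pairwise_def disjnt_def) presburger+
    show "card (?e ` {..<m}) = m" using card_image[OF inj] by simp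
  qed
  then show ?thesis by blast
qed

lemma card_Union_edges:
  assumes "G \<in> partial_matchings n m" "E \<subseteq> G"
  shows "card (\<Union>E) = 2 * card E"
proof -
  note G = partial_matchingsD[OF assms(1)]
  have "card (\<Union>E) = sum card E"
    using G assms(2) by (intro card_Union_disjoint) (auto intro: pairwise_subset)
  also have "\<dots> = (\<Sum>e\<in>E. 2)" using G assms(2) by (intro sum.cong) auto
  finally show ?thesis by simp
qed

text \<open>An edge of the matching inside \<open>\<Union>E\<close> meets a member of
  \<open>E\<close>, so disjointness forces it to be that member. Sums over edge sets can thus be
  reindexed by the vertices they cover.\<close>

lemma inj_on_Union_edges:
  assumes "G \<in> partial_matchings n m"
  shows "inj_on Union (Pow G)"
proof (rule inj_on_inverseI[where g = "\<lambda>T. {e \<in> G. e \<subseteq> T}"])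
  note G = partial_matchingsD[OF assms]
  fix E assume E: "E \<in> Pow G"
  have "e \<in> E" if e: "e \<in> G" "e \<subseteq> \<Union>E" for e
  proof -
    have "e \<noteq> {}" using G(6)[OF e(1)] by auto
    then obtain v where "v \<in> e" by blast
    then obtain e' where "e' \<in> E" "v \<in> e'" using e by blast
    then have "e' \<in> G" "\<not> disjnt e e'" using \<open>v \<in> e\<close> E by (auto simp: disjnt_def)
    then have "e = e'" using e G(3) by (metis pairwiseD)
    then show ?thesis using \<open>e' \<in> E\<close> by simp
  qed
  then show "{e \<in> G. e \<subseteq> \<Union>E} = E" using E by auto
qed

definition matchings_covering :: "nat \<Rightarrow> nat \<Rightarrow> nat set \<Rightarrow> nat set set set" where
  "matchings_covering n m T = {G \<in> partial_matchings n m. \<exists>E\<subseteq>G. \<Union>E = T}"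

lemma finite_matchings_covering [simp]: "finite (matchings_covering n m T)"
  by (simp add: matchings_covering_def)

text \<open>A permutation of the vertices that carries \<open>T\<close> to \<open>T'\<close> acts
  injectively on matchings. One inequality suffices, as \<open>T\<close> and \<open>T'\<close> can
  be exchanged.\<close>

lemma card_matchings_covering_le:
  assumes T: "T \<subseteq> {1..n}" "T' \<subseteq> {1..n}" "card T = card T'"
  shows "card (matchings_covering n m T) \<le> card (matchings_covering n m T')"
proof -
  let ?V = "{1..n}"
  have fin: "finite T" "finite T'" using T finite_subset by blast+
  obtain g where g: "bij_betw g T T'" using finite_same_card_bij[OF fin T(3)] by blast
  have "card (?V - T) = card (?V - T')" using T fin by (simp add: card_Diff_subset)
  then obtain h where h: "bij_betw h (?V - T) (?V - T')"
    using finite_same_card_bij[of "?V - T" "?V - T'"] by blast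
  define \<pi> where "\<pi> v = (if v \<in> T then g v else h v)" for v
  have bT: "bij_betw \<pi> T T'" using g by (subst bij_betw_cong[of T \<pi> g]) (auto simp: \<pi>_def)
  have "bij_betw \<pi> (?V - T) (?V - T')"
    using h by (subst bij_betw_cong[of "?V - T" \<pi> h]) (auto simp: \<pi>_def)
  with bT have "bij_betw \<pi> (T \<union> (?V - T)) (T' \<union> (?V - T'))"
    by (rule bij_betw_combine) auto
  then have bV: "bij_betw \<pi> ?V ?V" using T by (simp add: Un_absorb1)
  then have inj: "inj_on \<pi> ?V" and im: "\<pi> ` ?V = ?V" by (auto simp: bij_betw_def)
  have inj2: "inj_on ((`) \<pi>) (Pow ?V)" using inj by (rule inj_on_image_Pow)
  let ?\<Phi> = "(`) ((`) \<pi>) :: nat set set \<Rightarrow> nat set set"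
  show ?thesis
  proof (rule card_inj_on_le[where f = ?\<Phi>])
    have "matchings_covering n m T \<subseteq> Pow (Pow ?V)"
      by (auto simp: matchings_covering_def partial_matchings_def)
    then show "inj_on ?\<Phi> (matchings_covering n m T)"
      using inj_on_image_Pow[OF inj2] inj_on_subset by blast
    show "?\<Phi> ` matchings_covering n m T \<subseteq> matchings_covering n m T'"
    proof
      fix H assume "H \<in> ?\<Phi> ` matchings_covering n m T"
      then obtain G E where H: "H = ?\<Phi> G" and G: "G \<in> partial_matchings n m" and E: "E \<subseteq> G" "\<Union>E = T"
        by (auto simp: matchings_covering_def)
      note GD = partial_matchingsD[OF G]
      have GP: "G \<subseteq> Pow ?V" using GD by auto
      have "H \<in> partial_matchings n m"
        unfolding partial_matchings_def
      proof (intro CollectI conjI ballI)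
        fix e assume "e \<in> H"
        then obtain d where d: "d \<in> G" "e = \<pi> ` d" by (auto simp: H)
        have dV: "d \<subseteq> ?V" using GD d by blast
        then show "e \<subseteq> {1..n}" using d im by blast
        show "card e = 2" using card_image[OF inj_on_subset[OF inj dV]] d GD by simp
      next
        show "pairwise disjnt H"
        proof (rule pairwiseI)
          fix a b assume "a \<in> H" "b \<in> H" "a \<noteq> b"
          then obtain c d where cd: "c \<in> G" "d \<in> G" "a = \<pi> ` c" "b = \<pi> ` d" "c \<noteq> d" by (auto simp: H)
          then have "c \<inter> d = {}" using GD(3) by (auto simp: pairwise_def disjnt_def)
          then have "\<pi> ` c \<inter> \<pi> ` d = {}"
            using inj_on_image_Int[OF inj, of c d] GP cd by auto
          then show "disjnt a b" by (simp add: cd disjnt_def)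
        qed
        show "card H = m" unfolding H using card_image[OF inj_on_subset[OF inj2 GP]] GD by simp
      qed
      moreover have "?\<Phi> E \<subseteq> H" using E H by auto
      moreover have "\<Union>(?\<Phi> E) = T'" using E bT by (auto simp: bij_betw_def)
      ultimately show "H \<in> matchings_covering n m T'" by (auto simp: matchings_covering_def)
    qed
  qed simp
qed

text \<open>By symmetry the number of matchings covering \<open>T\<close> depends only on \<open>card T\<close>, and the case \<open>h = 1\<close> of
  the double count determines it.\<close>

lemma sum_over_edge_sets:
  fixes h :: "nat set \<Rightarrow> real"
  assumes "2 * k \<le> n"
  shows "(\<Sum>G\<in>partial_matchings n m. \<Sum>E | E \<subseteq> G \<and> card E = k. h (\<Union>E)) =
    card (partial_matchings n m) * (real (m choose k) / real (n choose (2 * k)))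
      * (\<Sum>T | T \<subseteq> {1..n} \<and> card T = 2 * k. h T)"
proof -
  let ?\<T> = "{T. T \<subseteq> {1..n} \<and> card T = 2 * k}"
  let ?PM = "partial_matchings n m"
  have finT: "finite ?\<T>" by (rule finite_subset[of _ "Pow {1..n}"]) auto
  have gen: "(\<Sum>G\<in>?PM. \<Sum>E | E \<subseteq> G \<and> card E = k. h (\<Union>E)) =
     (\<Sum>T\<in>?\<T>. h T * card (matchings_covering n m T))" for h :: "nat set \<Rightarrow> real"
  proof -
    have "(\<Sum>E | E \<subseteq> G \<and> card E = k. h (\<Union>E)) = (\<Sum>T\<in>?\<T>. if \<exists>E\<subseteq>G. \<Union>E = T then h T else 0)"
      if G: "G \<in> ?PM" for G
    proof -
      have inj: "inj_on Union {E. E \<subseteq> G \<and> card E = k}"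
        using inj_on_Union_edges[OF G] by (rule inj_on_subset) auto
      have "Union ` {E. E \<subseteq> G \<and> card E = k} = {T \<in> ?\<T>. \<exists>E\<subseteq>G. \<Union>E = T}"
      proof (intro equalityI subsetI)
        fix T assume "T \<in> Union ` {E. E \<subseteq> G \<and> card E = k}"
        then obtain E where E: "E \<subseteq> G" "card E = k" "T = \<Union>E" by blast
        then have "T \<subseteq> {1..n}" using partial_matchingsD(4)[OF G] by blast
        then show "T \<in> {T \<in> ?\<T>. \<exists>E\<subseteq>G. \<Union>E = T}" using card_Union_edges[OF G E(1)] E by auto
      next
        fix T assume "T \<in> {T \<in> ?\<T>. \<exists>E\<subseteq>G. \<Union>E = T}"
        then obtain E where E: "E \<subseteq> G" "card T = 2 * k" "T = \<Union>E" by blast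
        then show "T \<in> Union ` {E. E \<subseteq> G \<and> card E = k}" using card_Union_edges[OF G E(1)] by auto
      qed
      then have "(\<Sum>E | E \<subseteq> G \<and> card E = k. h (\<Union>E)) = (\<Sum>T\<in>{T \<in> ?\<T>. \<exists>E\<subseteq>G. \<Union>E = T}. h T)"
        using sum.reindex[OF inj, of h] by (simp add: o_def)
      then show ?thesis using finT by (simp only: sum.inter_filter)
    qed
    then have "(\<Sum>G\<in>?PM. \<Sum>E | E \<subseteq> G \<and> card E = k. h (\<Union>E)) =
      (\<Sum>T\<in>?\<T>. \<Sum>G\<in>?PM. if \<exists>E\<subseteq>G. \<Union>E = T then h T else 0)"
      by (subst sum.swap) simp
    also have "\<dots> = (\<Sum>T\<in>?\<T>. h T * card (matchings_covering n m T))"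
      by (intro sum.cong refl) (simp add: matchings_covering_def flip: sum.inter_filter)
    finally show ?thesis .
  qed
  have "card ?\<T> = n choose (2 * k)" using n_subsets[of "{1..n}" "2 * k"] by simp
  moreover have pos: "n choose (2 * k) > 0" using assms by simp
  ultimately obtain T0 where T0: "T0 \<in> ?\<T>" by (metis (no_types, lifting) card_gt_0_iff ex_in_conv)
  define R where "R = card (matchings_covering n m T0)"
  have R: "card (matchings_covering n m T) = R" if "T \<in> ?\<T>" for T
    unfolding R_def using that T0 by (intro antisym card_matchings_covering_le) auto
  have "(\<Sum>G\<in>?PM. \<Sum>E | E \<subseteq> G \<and> card E = k. (1::real)) = (\<Sum>T\<in>?\<T>. real (card (matchings_covering n m T)))"
    using gen[of "\<lambda>_. 1"] by simp
  also have "\<dots> = real (n choose (2 * k)) * R"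
    using \<open>card ?\<T> = n choose (2 * k)\<close> R by simp
  also have "(\<Sum>G\<in>?PM. \<Sum>E | E \<subseteq> G \<and> card E = k. (1::real)) = (\<Sum>G\<in>?PM. real (m choose k))"
  proof (intro sum.cong refl)
    fix G assume G: "G \<in> ?PM"
    show "(\<Sum>E | E \<subseteq> G \<and> card E = k. (1::real)) = real (m choose k)"
      using n_subsets[OF partial_matchingsD(1)[OF G], of k] partial_matchingsD(2)[OF G] by simp
  qed
  finally have "real R = card ?PM * (real (m choose k) / real (n choose (2 * k)))"
    using pos by (simp add: field_simps)
  moreover have "(\<Sum>T\<in>?\<T>. h T * card (matchings_covering n m T)) = R * (\<Sum>T\<in>?\<T>. h T)"
    unfolding sum_distrib_left by (intro sum.cong refl) (simp add: R mult.commute)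
  ultimately show ?thesis unfolding gen by simp
qed

section \<open>Summing over the levels\<close>

definition cover_prob :: "nat \<Rightarrow> nat \<Rightarrow> nat \<Rightarrow> real" where
  "cover_prob m n k = real (m choose k) / real (n choose (2 * k))"

lemma Suc_times_binomial_Suc: "Suc k * (n choose Suc k) = (n - k) * (n choose k)"
  by (simp only: binomial_absorption binomial_absorb_comp)

lemma cover_prob_nonneg: "cover_prob m n k \<ge> 0"
  by (simp add: cover_prob_def)

text \<open>The ratio of consecutive values is
  \<open>2 (m - k) (2k + 1) / ((n - 2k - 1) (n - 2k))\<close>. The density bound
  \<open>4 * m \<le> n\<close> gives both \<open>2 (m - k) \<le> (n - 2k) / 2\<close> and
  \<open>n / 2 \<le> n - 2k - 1\<close>.\<close>

lemma cover_prob_Suc_le: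
  assumes "4 * m \<le> n" "k < m"
  shows "cover_prob m n (Suc k) \<le> 2 * real (Suc k) / real n * cover_prob m n k"
proof -
  define A B M N K where "A = real (m choose k)" and "B = real (n choose (2 * k))"
    and "M = real m" and "N = real n" and "K = real k"
  have kn: "2 * k + 2 \<le> n" using assms by linarith
  have "real (Suc k * (m choose Suc k)) = real ((m - k) * (m choose k))"
    by (simp only: Suc_times_binomial_Suc)
  then have A: "real (m choose Suc k) = (M - K) * A / (K + 1)"
    using assms(2) by (simp add: A_def M_def K_def of_nat_diff field_simps)
  have "real (Suc (2 * k) * (n choose Suc (2 * k))) = real ((n - 2 * k) * (n choose (2 * k)))"
    by (simp only: Suc_times_binomial_Suc)
  then have B1: "real (n choose Suc (2 * k)) = (N - 2 * K) * B / (2 * K + 1)"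
    using kn by (simp add: B_def N_def K_def of_nat_diff field_simps)
  have "real (Suc (Suc (2 * k)) * (n choose Suc (Suc (2 * k)))) = real ((n - Suc (2 * k)) * (n choose Suc (2 * k)))"
    by (simp only: Suc_times_binomial_Suc)
  then have B2: "real (n choose (2 * Suc k)) = (N - 2 * K - 1) * ((N - 2 * K) * B / (2 * K + 1)) / (2 * K + 2)"
  proof -
    have "(2 * K + 2) * real (n choose (2 * Suc k)) = (N - 2 * K - 1) * real (n choose Suc (2 * k))"
      using \<open>real (Suc (Suc (2 * k)) * (n choose Suc (Suc (2 * k)))) = _\<close> kn
      by (simp add: N_def K_def of_nat_diff add.commute diff_diff_eq distrib_right)
    moreover have "2 * K + 2 \<noteq> 0" by (simp add: K_def add_nonneg_eq_0_iff)
    ultimately show ?thesis unfolding B1 by (metis nonzero_mult_div_cancel_left)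
  qed
  have pos: "B > 0" "A \<ge> 0" "K \<ge> 0" using kn by (auto simp: A_def B_def K_def)
  have le: "4 * M \<le> N" "K + 1 \<le> M" using assms by (auto simp: M_def N_def K_def)
  have "cover_prob m n (Suc k) = (M - K) * A / (K + 1) / ((N - 2 * K - 1) * ((N - 2 * K) * B / (2 * K + 1)) / (2 * K + 2))"
    unfolding cover_prob_def A B2 ..
  also have "\<dots> = 2 * (M - K) * (2 * K + 1) / ((N - 2 * K - 1) * (N - 2 * K)) * (A / B)"
    using pos le by (simp add: divide_simps) (simp add: algebra_simps)
  also have "\<dots> \<le> 2 * (K + 1) / N * (A / B)"
  proof (rule mult_right_mono)
    have "2 * (M - K) * (2 * K + 1) * N \<le> (N - 2 * K) * (2 * K + 2) * (N - 2 * K - 1)"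
    proof -
      have "2 * (M - K) * (2 * K + 1) * N \<le> (N - 2 * K) / 2 * (2 * K + 2) * N"
        using le pos by (intro mult_mono) auto
      also have "\<dots> = (N - 2 * K) * (2 * K + 2) * (N / 2)" by simp
      also have "\<dots> \<le> (N - 2 * K) * (2 * K + 2) * (N - 2 * K - 1)"
        using le pos by (intro mult_left_mono) auto
      finally show ?thesis .
    qed
    then show "2 * (M - K) * (2 * K + 1) / ((N - 2 * K - 1) * (N - 2 * K)) \<le> 2 * (K + 1) / N"
      using le pos by (simp add: frac_le_eq divide_le_0_iff) (simp add: divide_simps algebra_simps)
  qed (use pos in auto)
  finally show ?thesis by (simp add: cover_prob_def A_def B_def K_def N_def mult_ac add.commute)
qed

lemma cover_prob_antimono:
  assumes "4 * m \<le> n" "k \<le> l"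
  shows "cover_prob m n l \<le> cover_prob m n k"
  using assms(2)
proof (induction l rule: dec_induct)
  case (step l)
  show ?case
  proof (cases "l < m")
    case True
    then have "2 * real (Suc l) / real n \<le> 1" using assms(1) by (simp add: divide_simps)
    then have "2 * real (Suc l) / real n * cover_prob m n l \<le> 1 * cover_prob m n l"
      by (rule mult_right_mono) (rule cover_prob_nonneg)
    then show ?thesis using cover_prob_Suc_le[OF assms(1) True] step.IH by linarith
  qed (use cover_prob_nonneg[of m n k] in \<open>simp add: cover_prob_def[of m n "Suc l"] binomial_eq_0\<close>)
qed simp

text \<open>Iterating the ratio yields a factorial, weakened to \<open>k ^ k\<close> so that it
  cancels against half of the \<open>k ^ (2 * k)\<close> in the denominator of the level
  inequality.\<close>

lemma cover_prob_le_power: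
  assumes "4 * m \<le> n"
  shows "cover_prob m n k \<le> (2 * real k / real n) ^ k"
proof -
  have "cover_prob m n k \<le> fact k * (2 / real n) ^ k"
  proof (induction k)
    case (Suc k)
    show ?case
    proof (cases "k < m")
      case True
      have "cover_prob m n (Suc k) \<le> 2 * real (Suc k) / real n * cover_prob m n k"
        by (rule cover_prob_Suc_le[OF assms True])
      also have "\<dots> \<le> 2 * real (Suc k) / real n * (fact k * (2 / real n) ^ k)"
        by (intro mult_left_mono Suc) simp
      also have "\<dots> = fact (Suc k) * (2 / real n) ^ Suc k"
        by (simp only: fact_Suc power_Suc of_nat_mult of_nat_fact) simp
      finally show ?thesis .
    qed (simp add: cover_prob_def binomial_eq_0)
  qed (simp add: cover_prob_def)
  also have "\<dots> \<le> real k ^ k * (2 / real n) ^ k"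
    using fact_le_power[of k, where 'a = real] by (intro mult_right_mono) (simp_all flip: of_nat_power)
  finally show ?thesis by (simp add: power_mult_distrib mult.commute power_divide)
qed

section \<open>Cover probabilities against level weights\<close>

lemma sum_power_le:
  assumes "0 \<le> r" "r \<le> 1 / 2"
  shows "(\<Sum>k\<in>{1..K}. r ^ k) \<le> 2 * (r :: real)"
proof -
  have "(\<Sum>k\<in>{1..K}. r ^ k) + r ^ K * r / (1 - r) \<le> r / (1 - r)"
  proof (induction K)
    case (Suc K)
    have "r ^ Suc K + r ^ Suc K * r / (1 - r) = r ^ K * r / (1 - r)"
      using assms by (simp add: field_simps)
    with Suc show ?case by simp
  qed simp
  moreover have "r ^ K * r / (1 - r) \<ge> 0" using assms by simp
  moreover have "r / (1 - r) \<le> 2 * r"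
  proof -
    have "r * 1 \<le> r * (2 * (1 - r))" using assms by (intro mult_left_mono) auto
    then show ?thesis using assms by (simp add: divide_simps mult_ac)
  qed
  ultimately show ?thesis by linarith
qed

text \<open>Up to \<open>K = \<lfloor>L\<rfloor>\<close> the level bounds give a geometric series; beyond \<open>K\<close>, where they fail, the
  total weight \<open>exp (L - 1)\<close> is absorbed by \<open>cover_prob m n K\<close>.\<close>

lemma weighted_level_sum_le:
  fixes V :: "nat \<Rightarrow> real"
  assumes mn: "4 * m \<le> n" and c: "c \<ge> exp 1" and L: "L \<ge> 1" and small: "4 * c\<^sup>2 * L\<^sup>2 \<le> real n"
    and V0: "\<And>k. V k \<ge> 0"
    and low: "\<And>k. 1 \<le> k \<Longrightarrow> real k \<le> L \<Longrightarrow> V k \<le> (c * L / k) ^ (2 * k)"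
    and total: "(\<Sum>k\<in>{1..m}. V k) \<le> exp (L - 1)"
  shows "(\<Sum>k\<in>{1..m}. cover_prob m n k * V k) \<le> 6 * c\<^sup>2 * L\<^sup>2 / n"
proof -
  \<comment> \<open>The ratio of the geometric series; \<open>small\<close> says exactly that it is
    at most 1/2. The levels up to \<open>K\<close> cost \<open>2 * r\<close> and the others
    \<open>r\<close>, whence the constant 6.\<close>
  define r where "r = 2 * c\<^sup>2 * L\<^sup>2 / n"
  have c0: "c > 0" "c \<ge> 1" using c exp_ge_add_one_self[of 1] by linarith+
  then have "4 * c\<^sup>2 * L\<^sup>2 > 0" using L by simp
  then have n: "real n > 0" using small by linarith
  have r: "0 \<le> r" "r \<le> 1 / 2" using small n by (auto simp: r_def divide_simps)
  define K where "K = nat \<lfloor>L\<rfloor>"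
  have K: "1 \<le> K" "real K \<le> L" "L < K + 1" using L by (auto simp: K_def) linarith+
  have "(\<Sum>k\<in>{1..m}. cover_prob m n k * V k) \<le>
      (\<Sum>k\<in>{1..m}. (if k \<le> K then r ^ k else 0) + cover_prob m n K * V k)"
  proof (intro sum_mono)
    fix k assume k: "k \<in> {1..m}"
    show "cover_prob m n k * V k \<le> (if k \<le> K then r ^ k else 0) + cover_prob m n K * V k"
    proof (cases "k \<le> K")
      case True
      then have kL: "real k \<le> L" using K by linarith
      have "cover_prob m n k * V k \<le> (2 * real k / n) ^ k * (c * L / k) ^ (2 * k)"
        using k kL low V0 by (intro mult_mono cover_prob_le_power[OF mn]) auto
      also have "\<dots> = (2 * real k / n * (c * L / k)\<^sup>2) ^ k"
        by (simp only: power_mult power_mult_distrib)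
      also have "2 * real k / n * (c * L / k)\<^sup>2 = r / k"
        using k by (simp add: r_def power2_eq_square)
      also have "(r / k) ^ k \<le> r ^ k"
        using r k by (intro power_mono) (auto simp: divide_le_eq mult_le_cancel_left1)
      finally show ?thesis using True V0 cover_prob_nonneg by (simp add: add_increasing2)
    next
      case False
      then show ?thesis using V0 by (simp add: mult_right_mono cover_prob_antimono[OF mn])
    qed
  qed
  also have "\<dots> = (\<Sum>k\<in>{1..m}. if k \<le> K then r ^ k else 0) + cover_prob m n K * (\<Sum>k\<in>{1..m}. V k)"
    by (simp add: sum.distrib sum_distrib_left)
  also have "(\<Sum>k\<in>{1..m}. if k \<le> K then r ^ k else 0) = (\<Sum>k\<in>{k \<in> {1..m}. k \<le> K}. r ^ k)"
    by (simp only: sum.inter_filter finite_atLeastAtMost)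
  also have "\<dots> \<le> (\<Sum>k\<in>{1..K}. r ^ k)"
    using r by (intro sum_mono2) auto
  also have "\<dots> \<le> 2 * r" by (rule sum_power_le[OF r])
  also have "cover_prob m n K * (\<Sum>k\<in>{1..m}. V k) \<le> r"
  proof -
    have "cover_prob m n K * (\<Sum>k\<in>{1..m}. V k) \<le> (2 * real K / n) ^ K * exp (L - 1)"
      by (intro mult_mono cover_prob_le_power[OF mn] total sum_nonneg V0) auto
    \<comment> \<open>As \<open>L - 1 < K\<close>, the total weight is at most
      \<open>exp 1 ^ K\<close> and merges into the K-th power. Its base stays below \<open>r\<close>
      because \<open>c \<ge> exp 1\<close>.\<close>
    also have "\<dots> \<le> (2 * real K / n) ^ K * exp 1 ^ K"
      using K by (intro mult_left_mono) (auto simp flip: exp_of_nat_mult)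
    also have "\<dots> = (2 * exp 1 * real K / n) ^ K" by (simp add: power_divide power_mult_distrib)
    also have "2 * exp 1 * real K / n \<le> r"
    proof -
      have "exp 1 * real K \<le> (c * c) * (L * L)"
        using c c0 L K mult_mono[of 1 c 1 c] mult_mono[of 1 L 1 L]
        by (intro mult_mono) (auto intro: order_trans[OF _ mult_right_mono[of 1 c c]] order_trans[OF _ mult_right_mono[of 1 L L]])
      then show ?thesis using n by (simp add: r_def power2_eq_square divide_right_mono)
    qed
    then have "(2 * exp 1 * real K / n) ^ K \<le> r ^ K" by (intro power_mono) auto
    also have "\<dots> \<le> r ^ 1" using r K by (intro power_decreasing) auto
    finally show ?thesis by simp
  qed
  finally show ?thesis by (simp add: r_def mult_ac)
qed

section \<open>Bias of the edge labels\<close>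

lemma incidence_mult_eq:
  assumes "e \<in> G" "e \<subseteq> {1..n}"
  shows "incidence_mult p n G x e = (\<Sum>v\<in>e. x v) mod p"
proof -
  have "(\<Sum>v\<in>{1..n}. incidence e v * x v) = (\<Sum>v\<in>{1..n}. if v \<in> e then x v else 0)"
    by (intro sum.cong refl) (simp add: incidence_def)
  also have "\<dots> = (\<Sum>v\<in>{v \<in> {1..n}. v \<in> e}. x v)"
    by (simp only: sum.inter_filter finite_atLeastAtMost)
  also have "{v \<in> {1..n}. v \<in> e} = e" using assms(2) by auto
  finally show ?thesis using assms(1) by (simp add: incidence_mult_def)
qed

lemma incidence_mult_Zvec:
  assumes "p \<ge> 1"
  shows "incidence_mult p n G x \<in> Zvec p G"
  using assms by (auto simp: incidence_mult_def Zvec_def)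

lemma incidence_mult_eq_iff:
  assumes "G \<in> partial_matchings n m"
  shows "incidence_mult p n G x = incidence_mult p n G y \<longleftrightarrow>
    (\<forall>e\<in>G. (\<Sum>v\<in>e. x v) mod p = (\<Sum>v\<in>e. y v) mod p)"
proof
  assume "incidence_mult p n G x = incidence_mult p n G y"
  then show "\<forall>e\<in>G. (\<Sum>v\<in>e. x v) mod p = (\<Sum>v\<in>e. y v) mod p"
    using incidence_mult_eq partial_matchingsD(4)[OF assms] by metis
next
  assume *: "\<forall>e\<in>G. (\<Sum>v\<in>e. x v) mod p = (\<Sum>v\<in>e. y v) mod p"
  show "incidence_mult p n G x = incidence_mult p n G y"
  proof
    fix e
    show "incidence_mult p n G x e = incidence_mult p n G y e"
    proof (cases "e \<in> G")
      case True
      then show ?thesis using * partial_matchingsD(4)[OF assms] by (simp add: incidence_mult_eq)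
    qed (simp add: incidence_mult_def)
  qed
qed

text \<open>On the left only those frequencies on \<open>\<Union>E\<close> occur that are constant
  on every edge, each of them once; the right side sums over all frequencies with this
  support.\<close>

lemma fweight_edges_le_level_weight:
  fixes f :: "(nat \<Rightarrow> nat) \<Rightarrow> real"
  assumes G: "G \<in> partial_matchings n m" and E: "E \<subseteq> G"
  shows "fweight p (Zvec p {1..n}) (\<lambda>e x. \<Sum>v\<in>e. x v) E f \<le> level_weight p {1..n} f (\<Union>E)"
proof -
  note GD = partial_matchingsD[OF G]
  have finU: "finite (\<Union>E)" using GD E finite_subset by blast
  \<comment> \<open>\<open>\<Phi> s\<close> is the vector \<open>M\<^sup>T s\<close>; the edge is unique because \<open>G\<close> is a matching.\<close>
  define edge where "edge i = (THE e. e \<in> E \<and> i \<in> e)" for i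
  have edge: "edge i = e" if "e \<in> E" "i \<in> e" for e i
    unfolding edge_def
  proof (rule the_equality)
    fix e' assume e': "e' \<in> E \<and> i \<in> e'"
    then have "\<not> disjnt e' e" using that by (auto simp: disjnt_def)
    then show "e' = e" using GD(3) E e' that by (metis pairwiseD subsetD)
  qed (use that in simp)
  define \<Phi> where "\<Phi> s = (\<lambda>i\<in>\<Union>E. s (edge i))" for s :: "nat set \<Rightarrow> nat"
  have \<Phi>: "\<Phi> s i = s e" if "e \<in> E" "i \<in> e" for s e i
    using that edge[OF that] by (auto simp: \<Phi>_def)
  let ?S = "E \<rightarrow>\<^sub>E {1..<p}"
  have inj: "inj_on \<Phi> ?S"
  proof (rule inj_onI)
    fix s s' assume s: "s \<in> ?S" "s' \<in> ?S" "\<Phi> s = \<Phi> s'"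
    show "s = s'"
    proof (rule PiE_ext[OF s(1,2)])
      fix e assume e: "e \<in> E"
      then have "card e = 2" using GD E by auto
      then obtain i where i: "i \<in> e" by fastforce
      show "s e = s' e" using \<Phi>[OF e i, of s] \<Phi>[OF e i, of s'] s(3) by simp
    qed
  qed
  have coef: "fcoef p X (\<lambda>e x. \<Sum>v\<in>e. x v) E f s = fcoef p X (\<lambda>i x. x i) (\<Union>E) f (\<Phi> s)" for X s
  proof -
    have "(\<Prod>e\<in>E. rootu p ^ (s e * (\<Sum>v\<in>e. x v))) = (\<Prod>i\<in>\<Union>E. rootu p ^ (\<Phi> s i * x i))" for x
    proof -
      have "(\<Prod>i\<in>\<Union>E. rootu p ^ (\<Phi> s i * x i)) = (\<Prod>e\<in>E. \<Prod>i\<in>e. rootu p ^ (\<Phi> s i * x i))"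
        using GD E by (subst prod.Union_disjoint) (auto simp: pairwise_def disjnt_def subset_iff)
      also have "\<dots> = (\<Prod>e\<in>E. \<Prod>i\<in>e. rootu p ^ (s e * x i))"
        by (intro prod.cong refl) (simp add: \<Phi>)
      finally show ?thesis by (simp add: sum_distrib_left power_sum)
    qed
    then show ?thesis by (simp add: fcoef_def)
  qed
  have "fweight p (Zvec p {1..n}) (\<lambda>e x. \<Sum>v\<in>e. x v) E f =
    (\<Sum>v\<in>\<Phi> ` ?S. (cmod (fcoef p (Zvec p {1..n}) (\<lambda>i x. x i) (\<Union>E) f v))\<^sup>2)"
    unfolding fweight_def coef by (subst sum.reindex[OF inj]) (simp only: o_def)
  also have "\<dots> \<le> level_weight p {1..n} f (\<Union>E)"
    unfolding level_weight_def fweight_def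
  proof (intro sum_mono2)
    show "finite (\<Union>E \<rightarrow>\<^sub>E {1..<p})" using finU by (intro finite_PiE) auto
    show "\<Phi> ` ?S \<subseteq> \<Union>E \<rightarrow>\<^sub>E {1..<p}"
    proof (rule image_subsetI)
      fix s assume s: "s \<in> ?S"
      show "\<Phi> s \<in> \<Union>E \<rightarrow>\<^sub>E {1..<p}"
      proof (rule PiE_I)
        fix i assume "i \<in> \<Union>E"
        then obtain e where "e \<in> E" "i \<in> e" by blast
        then show "\<Phi> s i \<in> {1..<p}" using PiE_mem[OF s \<open>e \<in> E\<close>] \<Phi> by metis
      qed (simp add: \<Phi>_def)
    qed
  qed auto
  finally show ?thesis .
qed

definition label_bias :: "nat \<Rightarrow> nat \<Rightarrow> nat set set \<Rightarrow> ((nat \<Rightarrow> nat) \<Rightarrow> real) \<Rightarrow> (nat set \<Rightarrow> nat) \<Rightarrow> real" where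
  "label_bias p n G f w = (\<Sum>x\<in>Zvec p {1..n}. f x *
     ((if incidence_mult p n G x = w then 1 else 0) - 1 / card (Zvec p G))) / card (Zvec p {1..n})"

text \<open>Parseval for the labels. The product of \<open>agree\<close> over \<open>G\<close>
  detects equal label vectors, and \<open>sum_fweight\<close> at \<open>t = 1\<close> expands it
  over subsets of \<open>G\<close>. Centring at the uniform law removes exactly the empty
  subset.\<close>

lemma sum_label_bias_squared:
  assumes p: "p \<ge> 1" and G: "G \<in> partial_matchings n m"
  shows "card (Zvec p G) * (\<Sum>w\<in>Zvec p G. (label_bias p n G f w)\<^sup>2) =
    (\<Sum>E\<in>Pow G - {{}}. fweight p (Zvec p {1..n}) (\<lambda>e x. \<Sum>v\<in>e. x v) E f)"
proof -
  let ?X = "Zvec p {1..n}" and ?W = "Zvec p G" and ?a = "\<lambda>e x. \<Sum>v\<in>e. (x v :: nat)"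
  let ?M = "incidence_mult p n G"
  define N where "N = real (card ?X)"
  define q where "q = real (card ?W)"
  note GD = partial_matchingsD[OF G]
  have finW: "finite ?W" using GD by simp
  have q: "q > 0" using finW Zvec_nonempty[OF p] by (simp add: q_def card_gt_0_iff)
  have pr: "(\<Prod>e\<in>G. agree p (?a e x) (?a e y)) = (if ?M x = ?M y then q else 0)" for x y
  proof (cases "?M x = ?M y")
    case True
    then have "\<forall>e\<in>G. agree p (?a e x) (?a e y) = real p"
      using incidence_mult_eq_iff[OF G] by (simp add: agree_def)
    then show ?thesis using True GD(1) by (simp add: q_def card_Zvec)
  next
    case False
    then have "\<exists>e\<in>G. agree p (?a e x) (?a e y) = 0"
      using incidence_mult_eq_iff[OF G] by (auto simp: agree_def)
    then show ?thesis using False GD(1) by (simp add: prod_zero)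
  qed
  have cov: "q * (\<Sum>w\<in>?W. ((if ?M x = w then 1 else 0) - 1 / q) * ((if ?M y = w then 1 else 0) - 1 / q))
      = (if ?M x = ?M y then q else 0) - 1" for x y
  proof -
    have mem: "?M x \<in> ?W" "?M y \<in> ?W" using incidence_mult_Zvec[OF p] by auto
    have "(\<Sum>w\<in>?W. ((if ?M x = w then 1 else 0) - 1 / q) * ((if ?M y = w then 1 else 0) - 1 / q)) =
      (\<Sum>w\<in>?W. (if ?M x = w then (if ?M x = ?M y then 1 else 0) else 0) - (if ?M x = w then 1 / q else 0)
         - (if ?M y = w then 1 / q else 0) + 1 / q\<^sup>2)"
      by (intro sum.cong refl) (auto simp: power2_eq_square algebra_simps)
    also have "\<dots> = (if ?M x = ?M y then 1 else 0) - 1 / q - 1 / q + q * (1 / q\<^sup>2)"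
      using mem finW by (simp add: sum.distrib sum_subtractf q_def)
    finally have "(\<Sum>w\<in>?W. ((if ?M x = w then 1 else 0) - 1 / q) * ((if ?M y = w then 1 else 0) - 1 / q)) =
      (if ?M x = ?M y then 1 else 0) - 1 / q" using q by (simp add: power2_eq_square)
    then show ?thesis using q by (simp add: right_diff_distrib)
  qed
  have "q * (\<Sum>w\<in>?W. (label_bias p n G f w)\<^sup>2) = q * (\<Sum>w\<in>?W. \<Sum>x\<in>?X. \<Sum>y\<in>?X. f x * f y *
     (((if ?M x = w then 1 else 0) - 1 / q) * ((if ?M y = w then 1 else 0) - 1 / q))) / N\<^sup>2"
    unfolding label_bias_def q_def[symmetric] N_def[symmetric] power_divide
    by (simp add: power2_eq_square sum_product mult_ac flip: sum_divide_distrib)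
  also have "(\<Sum>w\<in>?W. \<Sum>x\<in>?X. \<Sum>y\<in>?X. f x * f y *
     (((if ?M x = w then 1 else 0) - 1 / q) * ((if ?M y = w then 1 else 0) - 1 / q))) =
     (\<Sum>x\<in>?X. \<Sum>y\<in>?X. f x * f y * (\<Sum>w\<in>?W. 
     ((if ?M x = w then 1 else 0) - 1 / q) * ((if ?M y = w then 1 else 0) - 1 / q)))"
    by (subst sum.swap, rule sum.cong[OF refl], subst sum.swap) (simp add: sum_distrib_left)
  also have "q * \<dots> / N\<^sup>2 = (\<Sum>x\<in>?X. \<Sum>y\<in>?X. f x * f y * (q * (\<Sum>w\<in>?W. 
     ((if ?M x = w then 1 else 0) - 1 / q) * ((if ?M y = w then 1 else 0) - 1 / q)))) / N\<^sup>2"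
    by (simp only: sum_distrib_left mult.left_commute)
  also have "\<dots> = (\<Sum>x\<in>?X. \<Sum>y\<in>?X. f x * f y * (\<Prod>e\<in>G. agree p (?a e x) (?a e y))) / N\<^sup>2
      - (\<Sum>x\<in>?X. \<Sum>y\<in>?X. f x * f y) / N\<^sup>2"
    unfolding cov pr by (simp only: right_diff_distrib sum_subtractf diff_divide_distrib mult_1_right)
  also have "\<dots> = (\<Sum>E\<in>Pow G. fweight p ?X ?a E f) - fweight p ?X ?a {} f"
    using sum_fweight[OF p GD(1), of 1 ?X ?a f]
    by (simp add: fweight_empty N_def power_divide power2_eq_square sum_product)
  also have "\<dots> = (\<Sum>E\<in>Pow G - {{}}. fweight p ?X ?a E f)"
    using GD(1) by (simp add: sum_diff1)
  finally show ?thesis unfolding q_def .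
qed

lemma sum_abs_label_bias_le:
  assumes p: "p \<ge> 1" and G: "G \<in> partial_matchings n m"
  shows "(\<Sum>w\<in>Zvec p G. \<bar>label_bias p n G f w\<bar>)
    \<le> sqrt (\<Sum>E\<in>Pow G - {{}}. level_weight p {1..n} f (\<Union>E))"
proof (rule real_le_rsqrt)
  have "(\<Sum>w\<in>Zvec p G. 1 * \<bar>label_bias p n G f w\<bar>)\<^sup>2
      \<le> (\<Sum>w\<in>Zvec p G. 1\<^sup>2) * (\<Sum>w\<in>Zvec p G. \<bar>label_bias p n G f w\<bar>\<^sup>2)"
    by (rule Cauchy_Schwarz_ineq_sum)
  also have "\<dots> = (\<Sum>E\<in>Pow G - {{}}. fweight p (Zvec p {1..n}) (\<lambda>e x. \<Sum>v\<in>e. x v) E f)"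
    using sum_label_bias_squared[OF assms] by simp
  also have "\<dots> \<le> (\<Sum>E\<in>Pow G - {{}}. level_weight p {1..n} f (\<Union>E))"
    by (intro sum_mono fweight_edges_le_level_weight[OF G]) auto
  finally show "(\<Sum>w\<in>Zvec p G. \<bar>label_bias p n G f w\<bar>)\<^sup>2
      \<le> (\<Sum>E\<in>Pow G - {{}}. level_weight p {1..n} f (\<Union>E))" by simp
qed

section \<open>Average over the random matching\<close>

definition matching_bias :: "nat \<Rightarrow> nat \<Rightarrow> nat \<Rightarrow> ((nat \<Rightarrow> nat) \<Rightarrow> real) \<Rightarrow> real" where
  "matching_bias p n m f =
     (\<Sum>G\<in>partial_matchings n m. \<Sum>w\<in>Zvec p G. \<bar>label_bias p n G f w\<bar>) / card (partial_matchings n m)"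

definition level_sum :: "nat \<Rightarrow> nat \<Rightarrow> ((nat \<Rightarrow> nat) \<Rightarrow> real) \<Rightarrow> nat \<Rightarrow> real" where
  "level_sum p n f k = (\<Sum>T | T \<subseteq> {1..n} \<and> card T = 2 * k. level_weight p {1..n} f T)"

lemma level_sum_nonneg: "level_sum p n f k \<ge> 0"
  by (simp add: level_sum_def sum_nonneg level_weight_nonneg)

lemma matching_bias_le_levels:
  assumes p: "p \<ge> 1" and mn: "2 * m \<le> n"
  shows "matching_bias p n m f \<le> sqrt (\<Sum>k\<in>{1..m}. cover_prob m n k * level_sum p n f k)"
proof -
  let ?PM = "partial_matchings n m"
  define N where "N = real (card ?PM)"
  have N: "N > 0" using partial_matchings_nonempty[OF mn] by (simp add: N_def card_gt_0_iff)
  define Y where "Y G = (\<Sum>E\<in>Pow G - {{}}. level_weight p {1..n} f (\<Union>E))" for G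
  have Y0: "Y G \<ge> 0" for G by (simp add: Y_def sum_nonneg level_weight_nonneg)
  have YG: "Y G = (\<Sum>k\<in>{1..m}. \<Sum>E | E \<subseteq> G \<and> card E = k. level_weight p {1..n} f (\<Union>E))"
    if G: "G \<in> ?PM" for G
  proof -
    note GD = partial_matchingsD[OF G]
    have "Y G = (\<Sum>k\<in>{1..m}. sum (\<lambda>E. level_weight p {1..n} f (\<Union>E)) {E \<in> Pow G - {{}}. card E = k})"
      unfolding Y_def
    proof (rule sum.group[symmetric])
      show "card ` (Pow G - {{}}) \<subseteq> {1..m}"
      proof (rule image_subsetI)
        fix E assume E: "E \<in> Pow G - {{}}"
        then have "finite E" "card E \<le> m" using GD card_mono[of G E] finite_subset[of E G] by auto
        then show "card E \<in> {1..m}" using E by (auto simp: Suc_le_eq card_gt_0_iff)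
      qed
    qed (use GD in auto)
    also have "\<dots> = (\<Sum>k\<in>{1..m}. \<Sum>E | E \<subseteq> G \<and> card E = k. level_weight p {1..n} f (\<Union>E))"
      by (intro sum.cong refl) auto
    finally show ?thesis .
  qed
  have "(\<Sum>G\<in>?PM. Y G) = (\<Sum>k\<in>{1..m}. \<Sum>G\<in>?PM. \<Sum>E | E \<subseteq> G \<and> card E = k. level_weight p {1..n} f (\<Union>E))"
    by (subst sum.swap) (simp add: YG)
  also have "\<dots> = (\<Sum>k\<in>{1..m}. N * (cover_prob m n k * level_sum p n f k))"
  proof (intro sum.cong refl)
    fix k assume "k \<in> {1..m}"
    then have "2 * k \<le> n" using mn by simp
    then show "(\<Sum>G\<in>?PM. \<Sum>E | E \<subseteq> G \<and> card E = k. level_weight p {1..n} f (\<Union>E)) =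
        N * (cover_prob m n k * level_sum p n f k)"
      by (simp add: sum_over_edge_sets N_def cover_prob_def level_sum_def)
  qed
  finally have sY: "(\<Sum>G\<in>?PM. Y G) = N * (\<Sum>k\<in>{1..m}. cover_prob m n k * level_sum p n f k)"
    by (simp add: sum_distrib_left)
  have "(\<Sum>G\<in>?PM. sqrt (Y G)) \<le> N * sqrt (\<Sum>k\<in>{1..m}. cover_prob m n k * level_sum p n f k)"
  proof -
    \<comment> \<open>Jensen for the square root, as Cauchy-Schwarz against the constant 1: the
      average over matchings moves under the root, where \<open>sum_over_edge_sets\<close> evaluates
      it.\<close>
    have "(\<Sum>G\<in>?PM. 1 * sqrt (Y G))\<^sup>2 \<le> (\<Sum>G\<in>?PM. 1\<^sup>2) * (\<Sum>G\<in>?PM. (sqrt (Y G))\<^sup>2)"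
      by (rule Cauchy_Schwarz_ineq_sum)
    also have "\<dots> = N * (\<Sum>G\<in>?PM. Y G)" by (simp add: Y0 N_def)
    finally have "(\<Sum>G\<in>?PM. sqrt (Y G))\<^sup>2 \<le> N\<^sup>2 * (\<Sum>k\<in>{1..m}. cover_prob m n k * level_sum p n f k)"
      by (simp add: sY power2_eq_square)
    then have "(\<Sum>G\<in>?PM. sqrt (Y G)) \<le> sqrt (N\<^sup>2 * (\<Sum>k\<in>{1..m}. cover_prob m n k * level_sum p n f k))"
      by (rule real_le_rsqrt)
    then show ?thesis using N by (simp add: real_sqrt_mult)
  qed
  moreover have "(\<Sum>G\<in>?PM. \<Sum>w\<in>Zvec p G. \<bar>label_bias p n G f w\<bar>) \<le> (\<Sum>G\<in>?PM. sqrt (Y G))"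
    unfolding Y_def by (intro sum_mono sum_abs_label_bias_le[OF p])
  ultimately have "(\<Sum>G\<in>?PM. \<Sum>w\<in>Zvec p G. \<bar>label_bias p n G f w\<bar>)
      \<le> N * sqrt (\<Sum>k\<in>{1..m}. cover_prob m n k * level_sum p n f k)" by linarith
  then show ?thesis using N unfolding matching_bias_def N_def[symmetric]
    by (simp add: divide_le_eq mult.commute)
qed

lemma sum_level_sum_le:
  "(\<Sum>k\<in>{1..m}. level_sum p n f k) \<le> (\<Sum>T\<in>Pow {1..n} - {{}}. level_weight p {1..n} f T)"
proof -
  have "(\<Sum>k\<in>{1..m}. level_sum p n f k) =
    (\<Sum>T\<in>(\<Union>k\<in>{1..m}. {T. T \<subseteq> {1..n} \<and> card T = 2 * k}). level_weight p {1..n} f T)"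
    unfolding level_sum_def
    by (rule sum.UNION_disjoint[symmetric]) (auto intro: finite_subset[of _ "Pow {1..n}"])
  also have "\<dots> \<le> (\<Sum>T\<in>Pow {1..n} - {{}}. level_weight p {1..n} f T)"
    by (intro sum_mono2) (auto simp: level_weight_nonneg)
  finally show ?thesis .
qed

text \<open>Needed for protocols that send nothing, where the bound below does not vanish.\<close>

lemma matching_bias_const:
  assumes p: "p \<ge> 1" and mn: "2 * m \<le> n" and f: "\<And>x. x \<in> Zvec p {1..n} \<Longrightarrow> f x = 1"
  shows "matching_bias p n m f = 0"
proof -
  let ?X = "Zvec p {1..n}"
  have c: "card ?X > 0" using Zvec_nonempty[OF p] by (simp add: card_gt_0_iff)
  \<comment> \<open>The total weight and the weight of the empty support are both 1, so the other
    weights vanish.\<close>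
  have "(\<Sum>T\<in>Pow {1..n}. level_weight p {1..n} f T) = 1"
    using c f Zvec_nonempty[OF p] by (simp add: sum_level_weight[OF p])
  moreover have "level_weight p {1..n} f {} = 1"
    using c f Zvec_nonempty[OF p] by (simp add: level_weight_empty)
  ultimately have z: "(\<Sum>T\<in>Pow {1..n} - {{}}. level_weight p {1..n} f T) = 0"
    by (simp add: sum_diff1)
  have "(\<Sum>k\<in>{1..m}. level_sum p n f k) = 0"
    using sum_level_sum_le[of p n f m] z by (simp add: order_antisym sum_nonneg level_sum_nonneg)
  then have "\<forall>k\<in>{1..m}. level_sum p n f k = 0"
    by (simp add: sum_nonneg_eq_0_iff level_sum_nonneg)
  then have "matching_bias p n m f \<le> 0" using matching_bias_le_levels[OF p mn, of f] by simp
  moreover have "matching_bias p n m f \<ge> 0" by (simp add: matching_bias_def sum_nonneg)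
  ultimately show ?thesis by simp
qed

text \<open>Triangle inequality: the two measures being compared each have mass equal to the mean of
  \<open>f\<close>. This serves when \<open>n\<close> is too small for the level bounds, and when
  the mean is 0.\<close>

lemma matching_bias_le_mean:
  assumes p: "p \<ge> 1" and mn: "2 * m \<le> n" and f: "\<And>x. x \<in> Zvec p {1..n} \<Longrightarrow> 0 \<le> f x"
  shows "matching_bias p n m f \<le> 2 * ((\<Sum>x\<in>Zvec p {1..n}. f x) / card (Zvec p {1..n}))"
proof -
  let ?X = "Zvec p {1..n}" and ?PM = "partial_matchings n m"
  let ?\<mu> = "(\<Sum>x\<in>?X. f x) / card ?X"
  have "(\<Sum>w\<in>Zvec p G. \<bar>label_bias p n G f w\<bar>) \<le> 2 * ?\<mu>" if G: "G \<in> ?PM" for G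
  proof -
    have fin: "finite (Zvec p G)" using partial_matchingsD(1)[OF G] by simp
    then have c: "card (Zvec p G) > 0" using Zvec_nonempty[OF p] by (simp add: card_gt_0_iff)
    have "(\<Sum>w\<in>Zvec p G. \<bar>label_bias p n G f w\<bar>) \<le> (\<Sum>w\<in>Zvec p G. (\<Sum>x\<in>?X. f x *
        ((if incidence_mult p n G x = w then 1 else 0) + 1 / card (Zvec p G))) / card ?X)"
    proof (rule sum_mono)
      fix w
      let ?i = "\<lambda>x. if incidence_mult p n G x = w then 1 else 0 :: real"
      have "\<bar>\<Sum>x\<in>?X. f x * (?i x - 1 / card (Zvec p G))\<bar> \<le> (\<Sum>x\<in>?X. \<bar>f x * (?i x - 1 / card (Zvec p G))\<bar>)"
        by (rule sum_abs)
      also have "\<dots> \<le> (\<Sum>x\<in>?X. f x * (?i x + 1 / card (Zvec p G)))"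
      proof (rule sum_mono)
        fix x assume "x \<in> ?X"
        then have "\<bar>f x * (?i x - 1 / card (Zvec p G))\<bar> = f x * \<bar>?i x - 1 / card (Zvec p G)\<bar>"
          using f by (simp add: abs_mult)
        also have "\<dots> \<le> f x * (?i x + 1 / card (Zvec p G))"
          using f[OF \<open>x \<in> ?X\<close>] by (intro mult_left_mono) (auto simp: abs_if)
        finally show "\<bar>f x * (?i x - 1 / card (Zvec p G))\<bar> \<le> f x * (?i x + 1 / card (Zvec p G))" .
      qed
      finally show "\<bar>label_bias p n G f w\<bar> \<le> (\<Sum>x\<in>?X. f x * (?i x + 1 / card (Zvec p G))) / card ?X"
        by (simp add: label_bias_def divide_right_mono)
    qed
    also have "\<dots> = (\<Sum>x\<in>?X. f x * (\<Sum>w\<in>Zvec p G.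
        ((if incidence_mult p n G x = w then 1 else 0) + 1 / card (Zvec p G)))) / card ?X"
      unfolding sum_divide_distrib[symmetric] by (subst sum.swap) (simp add: sum_distrib_left)
    also have "\<dots> = (\<Sum>x\<in>?X. f x * 2) / card ?X"
      using c fin incidence_mult_Zvec[OF p] Zvec_nonempty[OF p, of G] by (simp add: sum.distrib)
    finally show ?thesis by (simp add: mult.commute sum_distrib_left)
  qed
  then have "(\<Sum>G\<in>?PM. \<Sum>w\<in>Zvec p G. \<bar>label_bias p n G f w\<bar>) \<le> (\<Sum>G\<in>?PM. 2 * ?\<mu>)"
    by (intro sum_mono)
  moreover have "card ?PM > 0" using partial_matchings_nonempty[OF mn] by (simp add: card_gt_0_iff)
  ultimately show ?thesis by (simp add: matching_bias_def divide_le_eq mult.commute)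
qed

lemma matching_bias_le:
  fixes f :: "(nat \<Rightarrow> nat) \<Rightarrow> real"
  assumes p: "p \<ge> 1" and mn: "4 * m \<le> n" and n: "n > 0"
    and f: "\<And>x. x \<in> Zvec p {1..n} \<Longrightarrow> 0 \<le> f x \<and> f x \<le> 1"
    and \<mu>: "\<mu> = (\<Sum>x\<in>Zvec p {1..n}. f x) / card (Zvec p {1..n})"
    and c: "c = 2 * (real p + 1) * exp 1"
  shows "matching_bias p n m f \<le> 4 * c * (\<mu> * (1 - ln \<mu>)) / sqrt n"
proof -
  have mn2: "2 * m \<le> n" using mn by simp
  let ?X = "Zvec p {1..n}"
  have card: "card ?X > 0" using Zvec_nonempty[OF p] by (simp add: card_gt_0_iff)
  have "(\<Sum>x\<in>?X. f x) \<le> (\<Sum>x\<in>?X. 1)" using f by (intro sum_mono) auto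
  then have \<mu>1: "\<mu> \<le> 1" using card by (simp add: \<mu> divide_le_eq_1)
  have \<mu>0: "\<mu> \<ge> 0" using f by (auto simp: \<mu> intro!: sum_nonneg divide_nonneg_nonneg)
  have triv: "matching_bias p n m f \<le> 2 * \<mu>"
    unfolding \<mu> using f by (intro matching_bias_le_mean[OF p mn2]) auto
  have ce: "c \<ge> exp 1" unfolding c by (rule order_trans[OF _ mult_right_mono[of 1]]) auto
  then have c0: "c > 0" using exp_gt_zero[of 1] by (meson less_le_trans)
  show ?thesis
  proof (cases "\<mu> = 0")
    \<comment> \<open>The factor \<mu> makes the right side 0 whatever the value of
      \<open>ln 0\<close>.\<close>
    case True
    then show ?thesis using triv by simp
  next
    case False
    then have pos: "\<mu> > 0" using \<mu>0 by simp
    define L where "L = 1 - ln \<mu>"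
    have L: "L \<ge> 1" using \<mu>1 pos by (simp add: L_def)
    have sn: "sqrt n > 0" using n by simp
    show ?thesis
    proof (cases "4 * c\<^sup>2 * L\<^sup>2 \<le> real n")
      case False
      \<comment> \<open>In this regime the claimed bound is at least \<open>2 * \<mu>\<close>. This
        case dictates the constant 4; in the other one \<open>sqrt 6\<close> would do.\<close>
      have "sqrt n \<le> 2 * c * L"
      proof (rule real_le_lsqrt)
        show "real n \<le> (2 * c * L)\<^sup>2" using False by (simp add: power_mult_distrib)
      qed (use c0 L in auto)
      then have "1 \<le> 2 * c * L / sqrt n" using sn by (simp add: le_divide_eq)
      then have "2 * \<mu> * 1 \<le> 2 * \<mu> * (2 * c * L / sqrt n)" using \<mu>0 by (intro mult_left_mono) auto
      then show ?thesis using triv by (simp add: L_def mult_ac)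
    next
      case True
      \<comment> \<open>After division by \<open>\<mu>\<^sup>2\<close> the level bounds depend on
        \<mu> only through \<open>L\<close>, and the bound \<mu> on the total weight becomes
        \<open>1 / \<mu> = exp (L - 1)\<close>.\<close>
      define V where "V k = level_sum p n f k / \<mu>\<^sup>2" for k
      have "(\<Sum>k\<in>{1..m}. cover_prob m n k * V k) \<le> 6 * c\<^sup>2 * L\<^sup>2 / n"
      proof (rule weighted_level_sum_le[OF mn ce L True])
        show "V k \<ge> 0" for k by (simp add: V_def level_sum_nonneg)
        show "V k \<le> (c * L / k) ^ (2 * k)" if "1 \<le> k" "real k \<le> L" for k
          using level_inequality[OF p _ f \<mu> pos that(1)] that(2) pos
          by (simp add: V_def level_sum_def L_def c divide_le_eq mult.commute)
        have "(\<Sum>k\<in>{1..m}. level_sum p n f k) \<le> (\<Sum>T\<in>Pow {1..n} - {{}}. level_weight p {1..n} f T)"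
          by (rule sum_level_sum_le)
        also have "\<dots> \<le> (\<Sum>T\<in>Pow {1..n}. level_weight p {1..n} f T)"
          by (intro sum_mono2) (auto simp: level_weight_nonneg)
        also have "\<dots> = (\<Sum>x\<in>?X. (f x)\<^sup>2) / card ?X" by (rule sum_level_weight[OF p]) simp
        also have "\<dots> \<le> \<mu>"
          unfolding \<mu> using f
          by (intro divide_right_mono sum_mono) (auto simp: power2_eq_square mult_left_le)
        finally have "(\<Sum>k\<in>{1..m}. level_sum p n f k) / \<mu>\<^sup>2 \<le> \<mu> / \<mu>\<^sup>2"
          by (rule divide_right_mono) simp
        also have "\<mu> / \<mu>\<^sup>2 = exp (L - 1)"
          using pos by (simp add: L_def exp_minus power2_eq_square divide_simps)
        finally show "(\<Sum>k\<in>{1..m}. V k) \<le> exp (L - 1)"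
          by (simp add: V_def sum_divide_distrib)
      qed
      then have "\<mu>\<^sup>2 * (\<Sum>k\<in>{1..m}. cover_prob m n k * V k) \<le> \<mu>\<^sup>2 * (6 * c\<^sup>2 * L\<^sup>2 / n)"
        by (rule mult_left_mono) simp
      also have "\<mu>\<^sup>2 * (\<Sum>k\<in>{1..m}. cover_prob m n k * V k) = (\<Sum>k\<in>{1..m}. cover_prob m n k * level_sum p n f k)"
        using pos by (simp add: sum_distrib_left V_def)
      also have "\<mu>\<^sup>2 * (6 * c\<^sup>2 * L\<^sup>2 / n) \<le> (4 * c * (\<mu> * L) / sqrt n)\<^sup>2"
        by (simp add: power_mult_distrib power_divide mult_ac divide_right_mono)
      finally have "sqrt (\<Sum>k\<in>{1..m}. cover_prob m n k * level_sum p n f k) \<le> 4 * c * (\<mu> * L) / sqrt n"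
        using c0 L \<mu>0 by (intro real_le_lsqrt) (auto intro!: sum_nonneg simp: cover_prob_nonneg level_sum_nonneg)
      then show ?thesis using matching_bias_le_levels[OF p mn2, of f] by (simp add: L_def)
    qed
  qed
qed

section \<open>One-way protocols\<close>

text \<open>Entropy is at most that of the uniform law. The inequality
  \<open>ln y \<le> y - 1\<close> at \<open>y = 1 / (N * \<mu> i)\<close> gives it term by term,
  with an error \<open>1 / N\<close> that sums to 1.\<close>

lemma sum_entropy_le:
  fixes \<mu> :: "'a \<Rightarrow> real"
  assumes "finite S" and "\<And>i. i \<in> S \<Longrightarrow> \<mu> i \<ge> 0" and "(\<Sum>i\<in>S. \<mu> i) = 1"
  shows "(\<Sum>i\<in>S. \<mu> i * (1 - ln (\<mu> i))) \<le> 1 + ln (card S)"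
proof -
  have "S \<noteq> {}" using assms(3) by auto
  define N where "N = real (card S)"
  have N: "N > 0" using assms(1) \<open>S \<noteq> {}\<close> by (simp add: N_def card_gt_0_iff)
  have "\<mu> i * (1 - ln (\<mu> i)) \<le> \<mu> i * ln N + 1 / N" if "i \<in> S" for i
  proof (cases "\<mu> i = 0")
    case False
    then have pos: "\<mu> i > 0" using assms(2)[OF that] by simp
    have "ln (1 / (N * \<mu> i)) \<le> 1 / (N * \<mu> i) - 1" using N pos by (intro ln_le_minus_one) simp
    then have "1 - ln (\<mu> i) \<le> ln N + 1 / (N * \<mu> i)" using N pos by (simp add: ln_div ln_mult)
    then have "\<mu> i * (1 - ln (\<mu> i)) \<le> \<mu> i * (ln N + 1 / (N * \<mu> i))" using pos by (intro mult_left_mono) auto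
    also have "\<dots> = \<mu> i * ln N + 1 / N" using pos by (simp add: distrib_left)
    finally show ?thesis .
  qed (use N in simp)
  then have "(\<Sum>i\<in>S. \<mu> i * (1 - ln (\<mu> i))) \<le> (\<Sum>i\<in>S. \<mu> i * ln N + 1 / N)" by (rule sum_mono)
  also have "\<dots> = ln N + 1"
    using N assms(3) by (simp add: sum.distrib N_def flip: sum_distrib_right)
  finally show ?thesis by (simp add: N_def)
qed

text \<open>For \<open>g\<close> the probability that Bob accepts, this is the contribution of one
  message and one matching to the difference between YES and NO.\<close>

lemma sum_label_bias_weighted:
  assumes p: "p \<ge> 1" and "finite G"
  shows "(\<Sum>w\<in>Zvec p G. g w * label_bias p n G f w) =
    (\<Sum>x\<in>Zvec p {1..n}. f x * g (incidence_mult p n G x)) / card (Zvec p {1..n})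
    - (\<Sum>x\<in>Zvec p {1..n}. f x * ((\<Sum>w\<in>Zvec p G. g w) / card (Zvec p G))) / card (Zvec p {1..n})"
proof -
  let ?X = "Zvec p {1..n}" and ?W = "Zvec p G" and ?M = "incidence_mult p n G"
  have "(\<Sum>w\<in>?W. g w * label_bias p n G f w) =
    (\<Sum>w\<in>?W. \<Sum>x\<in>?X. f x * (g w * ((if ?M x = w then 1 else 0) - 1 / card ?W))) / card ?X"
    unfolding label_bias_def sum_divide_distrib[of _ ?W] times_divide_eq_right
    by (simp add: sum_distrib_left mult_ac)
  also have "\<dots> = (\<Sum>x\<in>?X. f x * (\<Sum>w\<in>?W. g w * ((if ?M x = w then 1 else 0) - 1 / card ?W))) / card ?X"
    by (subst sum.swap) (simp only: sum_distrib_left)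
  also have "\<dots> = (\<Sum>x\<in>?X. f x * g (?M x) - f x * ((\<Sum>w\<in>?W. g w) / card ?W)) / card ?X"
  proof -
    have "(\<Sum>w\<in>?W. g w * ((if ?M x = w then 1 else 0) - 1 / card ?W)) = g (?M x) - (\<Sum>w\<in>?W. g w) / card ?W" for x
    proof -
      have "(\<Sum>w\<in>?W. g w * ((if ?M x = w then 1 else 0) - 1 / card ?W)) =
        (\<Sum>w\<in>?W. (if ?M x = w then g w else 0) - g w / card ?W)"
        by (intro sum.cong refl) (simp add: right_diff_distrib)
      also have "\<dots> = g (?M x) - (\<Sum>w\<in>?W. g w) / card ?W"
        using incidence_mult_Zvec[OF p, of n G x] assms(2)
        by (simp add: sum_subtractf sum_divide_distrib)
      finally show ?thesis .
    qed
    then show ?thesis by (simp only: right_diff_distrib)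
  qed
  finally show ?thesis by (simp only: sum_subtractf diff_divide_distrib)
qed

text \<open>With the message summed outermost, Bob's strategy is a weight between 0 and 1 on each
  label vector, so absolute values eliminate it.\<close>

lemma advantage_le_matching_bias:
  fixes A :: "(nat \<Rightarrow> nat) \<Rightarrow> 'msg pmf" and B :: "'msg \<Rightarrow> nat set set \<Rightarrow> (nat set \<Rightarrow> nat) \<Rightarrow> bool pmf"
  assumes p: "p \<ge> 1" and mn: "2 * m \<le> n" and S: "finite S"
    and A: "\<And>x. x \<in> Zvec p {1..n} \<Longrightarrow> set_pmf (A x) \<subseteq> S"
  shows "\<bar>pmf (yes_dist p n m \<bind> (\<lambda>(x, G, w). A x \<bind> (\<lambda>msg. B msg G w))) True
    - pmf (no_dist p n m \<bind> (\<lambda>(x, G, w). A x \<bind> (\<lambda>msg. B msg G w))) True\<bar>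
    \<le> (\<Sum>msg\<in>S. matching_bias p n m (\<lambda>x. pmf (A x) msg))"
proof -
  let ?X = "Zvec p {1..n}" and ?PM = "partial_matchings n m"
  define N where "N = real (card ?PM)"
  define q where "q = real (card ?X)"
  define g where "g msg G w = pmf (B msg G w) True" for msg G w
  define f where "f msg x = pmf (A x) msg" for msg x
  have finX: "finite ?X" by simp
  have neG: "Zvec p G \<noteq> {}" for G :: "nat set set" by (rule Zvec_nonempty[OF p])
  note ne = Zvec_nonempty[OF p, of "{1..n}"] partial_matchings_nonempty[OF mn]
  have N: "N > 0" using ne by (simp add: N_def card_gt_0_iff)
  have inner: "pmf (A x \<bind> (\<lambda>msg. B msg G w)) True = (\<Sum>msg\<in>S. f msg x * g msg G w)"
    if "x \<in> ?X" for x G w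
    unfolding pmf_bind using A[OF that] S
    by (subst integral_measure_pmf[of S]) (auto simp: f_def g_def)
  have yes: "pmf (yes_dist p n m \<bind> (\<lambda>(x, G, w). A x \<bind> (\<lambda>msg. B msg G w))) True =
    (\<Sum>x\<in>?X. (\<Sum>G\<in>?PM. \<Sum>msg\<in>S. f msg x * g msg G (incidence_mult p n G x)) / N) / q"
    using ne finX
    by (simp add: yes_dist_def bind_assoc_pmf bind_return_pmf pmf_bind_pmf_of_set inner N_def q_def)
  have no: "pmf (no_dist p n m \<bind> (\<lambda>(x, G, w). A x \<bind> (\<lambda>msg. B msg G w))) True =
    (\<Sum>x\<in>?X. (\<Sum>G\<in>?PM. (\<Sum>w\<in>Zvec p G. \<Sum>msg\<in>S. f msg x * g msg G w) / card (Zvec p G)) / N) / q"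
    using ne neG finX partial_matchingsD(1)
    by (simp add: no_dist_def bind_assoc_pmf bind_return_pmf pmf_bind_pmf_of_set inner N_def q_def)
  have yes': "pmf (yes_dist p n m \<bind> (\<lambda>(x, G, w). A x \<bind> (\<lambda>msg. B msg G w))) True =
    (\<Sum>msg\<in>S. \<Sum>G\<in>?PM. (\<Sum>x\<in>?X. f msg x * g msg G (incidence_mult p n G x)) / q) / N"
  proof -
    have "(\<Sum>x\<in>?X. (\<Sum>G\<in>?PM. \<Sum>msg\<in>S. f msg x * g msg G (incidence_mult p n G x)) / N) / q =
      (\<Sum>x\<in>?X. \<Sum>G\<in>?PM. \<Sum>msg\<in>S. f msg x * g msg G (incidence_mult p n G x)) / q / N"
      by (simp add: mult.commute flip: sum_divide_distrib)
    also have "(\<Sum>x\<in>?X. \<Sum>G\<in>?PM. \<Sum>msg\<in>S. f msg x * g msg G (incidence_mult p n G x)) =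
      (\<Sum>G\<in>?PM. \<Sum>msg\<in>S. \<Sum>x\<in>?X. f msg x * g msg G (incidence_mult p n G x))"
      by (subst sum.swap, rule sum.cong[OF refl], rule sum.swap)
    also have "\<dots> = (\<Sum>msg\<in>S. \<Sum>G\<in>?PM. \<Sum>x\<in>?X. f msg x * g msg G (incidence_mult p n G x))"
      by (rule sum.swap)
    finally show ?thesis unfolding yes by (simp add: sum_divide_distrib)
  qed
  have no': "pmf (no_dist p n m \<bind> (\<lambda>(x, G, w). A x \<bind> (\<lambda>msg. B msg G w))) True =
    (\<Sum>msg\<in>S. \<Sum>G\<in>?PM. (\<Sum>x\<in>?X. f msg x * ((\<Sum>w\<in>Zvec p G. g msg G w) / card (Zvec p G))) / q) / N"
  proof -
    have "(\<Sum>x\<in>?X. (\<Sum>G\<in>?PM. (\<Sum>w\<in>Zvec p G. \<Sum>msg\<in>S. f msg x * g msg G w) / card (Zvec p G)) / N) / q =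
      (\<Sum>x\<in>?X. \<Sum>G\<in>?PM. (\<Sum>w\<in>Zvec p G. \<Sum>msg\<in>S. f msg x * g msg G w) / card (Zvec p G)) / q / N"
      by (simp add: mult.commute flip: sum_divide_distrib)
    also have "(\<Sum>x\<in>?X. \<Sum>G\<in>?PM. (\<Sum>w\<in>Zvec p G. \<Sum>msg\<in>S. f msg x * g msg G w) / card (Zvec p G)) =
      (\<Sum>x\<in>?X. \<Sum>G\<in>?PM. \<Sum>msg\<in>S. f msg x * ((\<Sum>w\<in>Zvec p G. g msg G w) / card (Zvec p G)))"
    proof (intro sum.cong refl)
      fix x G
      show "(\<Sum>w\<in>Zvec p G. \<Sum>msg\<in>S. f msg x * g msg G w) / card (Zvec p G) =
          (\<Sum>msg\<in>S. f msg x * ((\<Sum>w\<in>Zvec p G. g msg G w) / card (Zvec p G)))"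
        by (subst sum.swap) (simp add: sum_divide_distrib sum_distrib_left)
    qed
    also have "\<dots> = (\<Sum>G\<in>?PM. \<Sum>msg\<in>S. \<Sum>x\<in>?X. f msg x * ((\<Sum>w\<in>Zvec p G. g msg G w) / card (Zvec p G)))"
      by (subst sum.swap, rule sum.cong[OF refl], rule sum.swap)
    also have "\<dots> = (\<Sum>msg\<in>S. \<Sum>G\<in>?PM. \<Sum>x\<in>?X. f msg x * ((\<Sum>w\<in>Zvec p G. g msg G w) / card (Zvec p G)))"
      by (rule sum.swap)
    finally show ?thesis unfolding no by (simp add: sum_divide_distrib)
  qed
  have "pmf (yes_dist p n m \<bind> (\<lambda>(x, G, w). A x \<bind> (\<lambda>msg. B msg G w))) True
    - pmf (no_dist p n m \<bind> (\<lambda>(x, G, w). A x \<bind> (\<lambda>msg. B msg G w))) True =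
    (\<Sum>msg\<in>S. \<Sum>G\<in>?PM. \<Sum>w\<in>Zvec p G. g msg G w * label_bias p n G (f msg) w) / N"
    unfolding yes' no' q_def using partial_matchingsD(1)
    by (simp add: sum_label_bias_weighted[OF p] sum_subtractf diff_divide_distrib)
  also have "\<bar>\<dots>\<bar> \<le> (\<Sum>msg\<in>S. \<Sum>G\<in>?PM. \<Sum>w\<in>Zvec p G. \<bar>label_bias p n G (f msg) w\<bar>) / N"
  proof -
    have "\<bar>\<Sum>msg\<in>S. \<Sum>G\<in>?PM. \<Sum>w\<in>Zvec p G. g msg G w * label_bias p n G (f msg) w\<bar>
      \<le> (\<Sum>msg\<in>S. \<Sum>G\<in>?PM. \<Sum>w\<in>Zvec p G. \<bar>g msg G w * label_bias p n G (f msg) w\<bar>)"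
      by (rule order_trans[OF sum_abs], rule sum_mono, rule order_trans[OF sum_abs], rule sum_mono, rule sum_abs)
    also have "\<dots> \<le> (\<Sum>msg\<in>S. \<Sum>G\<in>?PM. \<Sum>w\<in>Zvec p G. \<bar>label_bias p n G (f msg) w\<bar>)"
    proof (intro sum_mono)
      fix msg G w
      show "\<bar>g msg G w * label_bias p n G (f msg) w\<bar> \<le> \<bar>label_bias p n G (f msg) w\<bar>"
        using mult_right_mono[of "g msg G w" 1 "\<bar>label_bias p n G (f msg) w\<bar>"]
        by (simp add: g_def abs_mult pmf_le_1)
    qed
    finally show ?thesis using N by (simp add: divide_right_mono)
  qed
  also have "\<dots> = (\<Sum>msg\<in>S. matching_bias p n m (\<lambda>x. pmf (A x) msg))"
  proof -
    have "f = (\<lambda>msg x. pmf (A x) msg)" by (simp add: f_def fun_eq_iff)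
    then show ?thesis by (simp add: matching_bias_def sum_divide_distrib N_def)
  qed
  finally show ?thesis .
qed

lemma advantage_le_one_seed:
  fixes A :: "(nat \<Rightarrow> nat) \<Rightarrow> bool list pmf"
  assumes p: "p \<ge> 1" and mn: "4 * m \<le> n" and n: "n > 0"
    and A: "\<And>x msg. x \<in> Zvec p {1..n} \<Longrightarrow> msg \<in> set_pmf (A x) \<Longrightarrow> length msg \<le> c"
  shows "\<bar>pmf (yes_dist p n m \<bind> (\<lambda>(x, G, w). A x \<bind> (\<lambda>msg. B msg G w))) True
    - pmf (no_dist p n m \<bind> (\<lambda>(x, G, w). A x \<bind> (\<lambda>msg. B msg G w))) True\<bar>
    \<le> 24 * (real p + 1) * exp 1 * c / sqrt n"
proof -
  let ?X = "Zvec p {1..n}"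
  define S where "S = {msg :: bool list. length msg \<le> c}"
  have S_eq: "S = {msg. set msg \<subseteq> UNIV \<and> length msg \<le> c}" by (simp add: S_def)
  have fin: "finite S" unfolding S_eq by (rule finite_lists_length_le) simp
  have AS: "set_pmf (A x) \<subseteq> S" if "x \<in> ?X" for x using A[OF that] by (auto simp: S_def)
  have sum1: "(\<Sum>msg\<in>S. pmf (A x) msg) = 1" if "x \<in> ?X" for x
    using AS[OF that] fin by (rule sum_pmf_eq_1[rotated])
  have mn2: "2 * m \<le> n" using mn by simp
  have le: "\<bar>pmf (yes_dist p n m \<bind> (\<lambda>(x, G, w). A x \<bind> (\<lambda>msg. B msg G w))) True
    - pmf (no_dist p n m \<bind> (\<lambda>(x, G, w). A x \<bind> (\<lambda>msg. B msg G w))) True\<bar>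
    \<le> (\<Sum>msg\<in>S. matching_bias p n m (\<lambda>x. pmf (A x) msg))"
    by (rule advantage_le_matching_bias[OF p mn2 fin AS])
  show ?thesis
  proof (cases "c = 0")
    case True
    then have "S = {[]}" by (auto simp: S_def)
    then have "matching_bias p n m (\<lambda>x. pmf (A x) []) = 0"
      using sum1 by (intro matching_bias_const[OF p mn2]) auto
    then show ?thesis using le \<open>S = {[]}\<close> True by simp
  next
    case False
    define \<mu> where "\<mu> msg = (\<Sum>x\<in>?X. pmf (A x) msg) / card ?X" for msg
    define \<kappa> where "\<kappa> = 2 * (real p + 1) * exp 1"
    have "(\<Sum>msg\<in>S. \<mu> msg) = (\<Sum>x\<in>?X. \<Sum>msg\<in>S. pmf (A x) msg) / card ?X"
      unfolding \<mu>_def by (subst sum.swap) (simp add: sum_divide_distrib)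
    also have "\<dots> = 1" using sum1 Zvec_nonempty[OF p] by simp
    finally have \<mu>1: "(\<Sum>msg\<in>S. \<mu> msg) = 1" .
    have "(\<Sum>msg\<in>S. matching_bias p n m (\<lambda>x. pmf (A x) msg))
      \<le> (\<Sum>msg\<in>S. 4 * \<kappa> * (\<mu> msg * (1 - ln (\<mu> msg))) / sqrt n)"
      by (intro sum_mono matching_bias_le[OF p mn n _ \<mu>_def \<kappa>_def]) (simp add: pmf_le_1)
    also have "\<dots> = 4 * \<kappa> / sqrt n * (\<Sum>msg\<in>S. \<mu> msg * (1 - ln (\<mu> msg)))"
      by (simp add: sum_distrib_left)
    also have "\<dots> \<le> 4 * \<kappa> / sqrt n * (3 * real c)"
    proof (rule mult_left_mono)
      have "(\<Sum>msg\<in>S. \<mu> msg * (1 - ln (\<mu> msg))) \<le> 1 + ln (card S)"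
        by (rule sum_entropy_le[OF fin _ \<mu>1]) (auto simp: \<mu>_def intro!: divide_nonneg_nonneg sum_nonneg)
      also have "ln (card S) \<le> ln (2 ^ (c + 1))"
      proof -
        have "card S = (\<Sum>i\<le>c. 2 ^ i)" unfolding S_eq by (subst card_lists_length_le) auto
        also have "\<dots> < 2 ^ (c + 1)" by (induction c) auto
        finally have "real (card S) \<le> 2 ^ (c + 1)" by (metis less_imp_le numeral_power_le_of_nat_cancel_iff of_nat_le_numeral_power_cancel_iff)
        moreover have "card S > 0" using fin by (auto simp: card_gt_0_iff S_def intro!: exI[of _ "[]"])
        ultimately show ?thesis by simp
      qed
      also have "ln (2 ^ (c + 1) :: real) = (real c + 1) * ln 2" by (simp only: ln_realpow) simp
      also have "\<dots> \<le> (real c + 1) * 1" using ln_2_less_1 by (intro mult_left_mono) auto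
      \<comment> \<open>Messages of every length up to \<open>c\<close> are counted, hence the
        exponent \<open>c + 1\<close>, and \<open>c + 2 \<le> 3 * c\<close> needs
        \<open>c \<ge> 1\<close>. The constant 24 is the product of 4, the 2 in \<kappa>, and this
        3.\<close>
      finally show "(\<Sum>msg\<in>S. \<mu> msg * (1 - ln (\<mu> msg))) \<le> 3 * real c" using False by simp
    qed (simp add: \<kappa>_def)
    also have "\<dots> = 24 * (real p + 1) * exp 1 * c / sqrt n" by (simp add: \<kappa>_def)
    finally show ?thesis using le by simp
  qed
qed

section \<open>Averaging over the public seed\<close>

lemma expectation_diff_le:
  fixes a b :: "'a \<Rightarrow> real"
  assumes a: "\<And>r. 0 \<le> a r \<and> a r \<le> 1" and b: "\<And>r. 0 \<le> b r \<and> b r \<le> 1"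
    and "\<And>r. r \<in> set_pmf M \<Longrightarrow> \<bar>a r - b r\<bar> \<le> B"
  shows "\<bar>measure_pmf.expectation M a - measure_pmf.expectation M b\<bar> \<le> B"
proof -
  have int: "integrable M a" "integrable M b"
    using a b by (auto intro!: measure_pmf.integrable_const_bound[where B = 1])
  have "measure_pmf.expectation M (\<lambda>r. a r - b r) \<le> B"
    using int assms(3) by (intro measure_pmf.integral_le_const) (auto simp: AE_measure_pmf_iff abs_le_iff)
  moreover have "measure_pmf.expectation M (\<lambda>r. b r - a r) \<le> B"
    using int assms(3) by (intro measure_pmf.integral_le_const) (auto simp: AE_measure_pmf_iff abs_le_iff)
  ultimately show ?thesis using int by simp
qed

theorem theorem3p1:
  fixes p :: nat and \<alpha> :: real
  assumes "p \<ge> 2" and "0 < \<alpha>" and "\<alpha> \<le> 1 / 4"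
  shows "\<exists>C>0. \<forall>(n::nat) (m::nat) (\<epsilon>::real) (P::protocol) (c::nat).
           real m = \<alpha> * real n \<longrightarrow> \<epsilon> > 0 \<longrightarrow>
           achieves_advantage p n m P \<epsilon> \<longrightarrow> communicates_at_most p n P c \<longrightarrow>
           real c \<ge> C * \<epsilon> * sqrt (real n)"
proof -
  define K where "K = 24 * (real p + 1) * exp 1"
  have K: "K > 0" by (simp add: K_def)
  show ?thesis
  proof (intro exI[of _ "1 / K"] conjI allI impI)
    show "1 / K > 0" using K by simp
    fix n m :: nat and \<epsilon> :: real and P :: protocol and c :: nat
    assume m: "real m = \<alpha> * real n" and "\<epsilon> > 0" and adv: "achieves_advantage p n m P \<epsilon>"
      and comm: "communicates_at_most p n P c"
    show "real c \<ge> 1 / K * \<epsilon> * sqrt (real n)"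
    proof (cases "n = 0")
      case False
      then have n: "n > 0" by simp
      have "4 * real m \<le> real n"
        using mult_right_mono[OF assms(3), of "real n"] m by simp
      then have mn: "4 * m \<le> n" by linarith
      have p: "p \<ge> 1" using assms(1) by simp
      let ?run = "\<lambda>D r. D \<bind> (\<lambda>(x, G, w). alice P r x \<bind> (\<lambda>msg. bob P r msg G w))"
      \<comment> \<open>The seed is drawn independently of the input, so the bound for a fixed seed
        passes to the average.\<close>
      have out: "pmf (bob_output P D) True = measure_pmf.expectation (seed P) (\<lambda>r. pmf (?run D r) True)" for D
        unfolding bob_output_def pmf_bind[of "seed P"] ..
      have "\<epsilon> \<le> \<bar>pmf (bob_output P (yes_dist p n m)) True - pmf (bob_output P (no_dist p n m)) True\<bar>"
        using adv by (simp add: achieves_advantage_def)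
      also have "\<dots> \<le> K * c / sqrt n"
        unfolding out K_def
      proof (rule expectation_diff_le)
        fix r assume "r \<in> set_pmf (seed P)"
        then show "\<bar>pmf (?run (yes_dist p n m) r) True - pmf (?run (no_dist p n m) r) True\<bar>
            \<le> 24 * (real p + 1) * exp 1 * c / sqrt n"
          using comm by (intro advantage_le_one_seed[OF p mn n]) (auto simp: communicates_at_most_def)
      qed (simp_all add: pmf_le_1)
      finally have "\<epsilon> * sqrt n \<le> K * c" using n by (simp add: le_divide_eq)
      then show ?thesis using K by (simp add: divide_le_eq mult.commute)
    qed simp
  qed
qed

end
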